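(* Suppose the standing assumptions (A1)–(A3) of the context hold, $\{x_k\}$ is an infinite sequence generated by the SQP algorithm of the context, and MFCQ is satisfied at all accumulation points of $\{x_k\}$. Suppose the potential function $L$ is a KL function, the constraint functions $c_i$, $i\in\mathcal E\cup\mathcal I$, are twice continuously differentiable, and (for $k$ large enough) there is $c_b\in(0,1)$ such that $B_k$ and its corresponding constant $b$ satisfy $c_bb-\bar\theta c_h\ge0$. Let $2b\ge l+\sigma$ and $l/c_b>b\ge\sigma\ge\rho$. Then the sequence $\{x_k\}$ converges to a KKT point of the problem.
   Context: Problem: $\mathcal E,\mathcal I$ are finite disjoint index sets, $m=|\mathcal E|+|\mathcal I|$, $c_i:\mathbb{R}^n\to\mathbb{R}$ for $i\in\mathcal E\cup\mathcal I$, $f:\mathbb{R}^n\to\mathbb{R}\cup\{+\infty\}$. Minimize $f(x)$ subject to $c_i(x)=0$ ($i\in\mathcal E$), $c_i(x)\ge0$ ($i\in\mathcal I$); the feasible set is $\Omega$. A KKT point is a feasible $\bar x$ for which there is $\bar\lambda\in\mathbb{R}^m$ with $0\in\bar\partial f(\bar x)-\sum_i\bar\lambda_i\nabla c_i(\bar x)$, and $\bar\lambda_i\ge0$, $\bar\lambda_ic_i(\bar x)=0$ for $i\in\mathcal I$. Notation: $[y]^-=\max\{0,-y\}$, $v(x)=\sum_{i\in\mathcal E}|c_i(x)|+\sum_{i\in\mathcal I}[c_i(x)]^-$, merit function $\phi(x,\theta)=f(x)+\theta v(x)$; $\bar\partial f$ is the Clarke subdifferential; $\|\cdot\|$ is the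 Euclidean norm. $f$ is upper-$C^2$ on an open set $O$ if near each point of $O$ it can be written $f(x)=\min_{t\in T}f_t(x)$ with $T$ a compact space, each $f_t$ of class $C^2$, and $f_t$ and its partial derivatives in $x$ up to order 2 jointly continuous in $(t,x)$. SQP algorithm: given $x_0$, $\theta_0>0$, $\eta\in(0,1)$, $\tau_\alpha\in(0,1)$, $\gamma>0$ (stopping tolerances zero: it stops only if $d_k=0$ and $v(x_k)=0$). At iteration $k$: take any $g_k\in\bar\partial f(x_k)$ and a symmetric matrix $B_k$; let $(d_k,v^k,w^k,t^k)$ solve $$\min_{d,v,w,t} f(x_k)+g_k^Td+\tfrac12 d^TB_kd+\theta_k\sum_{i\in\mathcal E}(v_i+w_i)+\theta_k\sum_{i\in\mathcal I}t_i$$ s.t. $c_i(x_k)+\nabla c_i(x_k)^Td=v_i-w_i$ ($i\in\mathcal E$), $c_i(x_k)+\nabla c_i(x_k)^Td\ge -t_i$ ($i\in\mathcal I$), $v,w,t\ge0$. $\Omega_k$ denotes the feasible region of this subproblem, written in the variables $x=x_k+d$ and $v,w,t$. Let $\lambda^{k+1}\in\mathbb{R}^m$ be the Lagrange multiplier of the linearized constraints, i.e. with some $p^{k+1},q^{k+1},r^{k+1}\ge0$: $g_k+B_kd_k-\sum_{i}\lambda_i^{k+1}\nabla c_i(x_k)=0$; $\lambda_i^{k+1}\ge0$ and $\lambda_i^{k+1}[c_i(x_k)+\nabla c_i(x_k)^Td_k+t_i^k]=0$ for $i\in\mathcal I$; $\theta_k+\lambda_i^{k+1}=p_i^{k+1}$,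 $\theta_k-\lambda_i^{k+1}=q_i^{k+1}$, $p_i^{k+1}v_i^k=q_i^{k+1}w_i^k=0$ for $i\in\mathcal E$; $\theta_k-\lambda_i^{k+1}=r_i^{k+1}$, $r_i^{k+1}t_i^k=0$ for $i\in\mathcal I$. Set $\theta_{k+1}=\max\{\theta_k,\|\lambda^{k+1}\|_\infty+\gamma\}$. Let $\alpha_k$ be the first of $1,\tau_\alpha,\tau_\alpha^2,\dots$ such that $\phi(x_k,\theta_k)-\phi(x_k+\alpha_kd_k,\theta_k)\ge\eta\alpha_k\tfrac12d_k^TB_kd_k$; set $x_{k+1}=x_k+\alpha_kd_k$. $\bar\theta$ denotes the eventual constant value of the penalty parameter: $\theta_k=\bar\theta$ for all $k$ large enough. Standing assumptions. (A1) $f$ is Lipschitz continuous and upper-$C^2$; $\rho>0$ is a constant such that $-f+\frac\rho2\|\cdot\|^2$ is convex on $D$ and $f(x)-f(\bar x)-\langle g,x-\bar x\rangle\le\frac\rho2\|x-\bar x\|^2$ for all $x,\bar x\in D$, $g\in\bar\partial f(\bar x)$. (A2) Each $c_i$ is continuously differentiable with Lipschitz gradient, and $H\ge0$ satisfies $|c_i(x')-c_i(x)-\nabla c_i(x)^T(x'-x)|\le\frac H2\|x-x'\|^2$ for all feasible $x,x'$ and all $i$; $c_h:=mH$. (A3) $\Omega$ and $\Omega_k$ are bounded for all $k$, and $D\subset\mathbb{R}^n$ is a convex compact set with $\Omega\subseteq D$ and $\Omega_k\subseteq D$ for all $k$ (the latter for the $x$ component); the $B_k$ are bounded and positive definite,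 and for some $b>0$, $d^TB_kd\ge b\|d\|^2$ for all $k$ and $d\in\mathbb{R}^n$. MFCQ: for a feasible point $x$ let $\mathcal A(x)=\mathcal E\cup\{i\in\mathcal I: c_i(x)=0\}$. MFCQ holds at $x$ if $\nabla c_i(x)$, $i\in\mathcal E$, are linearly independent and there is $w\in\mathbb{R}^n$ with $\nabla c_i(x)^Tw>0$ for all $i\in\mathcal A(x)\cap\mathcal I$ and $\nabla c_i(x)^Tw=0$ for all $i\in\mathcal E$. Potential function: $\sigma>0$, $l>0$ are constants; $F(x)=-f(x)+\frac12\sigma\|x\|^2$ for $x\in D$ and $F(x)=+\infty$ otherwise, with $\sigma$ such that $F$ is convex; $F^*(u)=\sup_x\{\langle u,x\rangle-F(x)\}$. Let $\bar c_i(x,w)=c_i(w)+\nabla c_i(w)^T(x-w)$, $\bar C=\{(x,w):\bar c_i(x,w)=0\ (i\in\mathcal E),\ \bar c_i(x,w)\ge0\ (i\in\mathcal I)\}$, and $i_{\bar C}$ its indicator function ($0$ on $\bar C$, $+\infty$ elsewhere). For $(x,y,w)\in(\mathbb{R}^n)^3$, $L(x,y,w)=-y^Tx+F^*(y)+\tfrac12\sigma\|x\|^2+\tfrac12 l\|x-w\|^2+i_{\bar C}(x,w)$. KL: $\partial$ denotes the limiting (general) subdifferential, $\mathrm{dom}\,\partial h=\{x:\partial h(x)\ne\emptyset\}$. A function $h$ has the KL property at $\hat x\in\mathrm{dom}\,\partial h$ if there are $a\in(0,\infty]$, a neighborhood $U$ of $\hat x$ and a continuous concave $\varphi:[0,a)\to[0,\infty)$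 with $\varphi(0)=0$, $\varphi\in C^1(0,a)$, $\varphi'>0$ on $(0,a)$, such that $\varphi'(h(x)-h(\hat x))\,\mathrm{dist}(0,\partial h(x))\ge1$ for all $x\in U$ with $h(\hat x)<h(x)<h(\hat x)+a$ (with $\mathrm{dist}(0,\emptyset)=+\infty$). $h$ is a KL function if this holds at each point of $\mathrm{dom}\,\partial h$.
   Formalization: Assumption (A3) that the subproblem regions Ω_k are bounded and lie in D cannot hold, since with the slack variables the x-component of Ω_k is all of R^n; it is replaced by its weaker consequence that x_k and x_k+d_k lie in D for all k. *)

theory Defs
  imports "HOL-Analysis.Analysis"
begin

section \<open>Generalized derivatives\<close>

definition grad :: "('a::real_inner \<Rightarrow> real) \<Rightarrow> 'a \<Rightarrow> 'a" where
  "grad h x = (THE g. GDERIV h x :> g)"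

definition C2_function :: "(real^'n \<Rightarrow> real) \<Rightarrow> bool" where
  "C2_function h \<longleftrightarrow>
     (\<forall>x. GDERIV h x :> grad h x) \<and>
     (\<exists>hess :: real^'n \<Rightarrow> real^'n^'n.
        (\<forall>x. (grad h has_derivative (\<lambda>u. hess x *v u)) (at x)) \<and> continuous_on UNIV hess)"

text \<open>Generalized directional derivative and Clarke subdifferential. They carry their usual meaning
  at points near which \<open>f\<close> is finite and Lipschitz.\<close>

definition clarke_dd :: "('a::real_inner \<Rightarrow> ereal) \<Rightarrow> 'a \<Rightarrow> 'a \<Rightarrow> ereal" where
  "clarke_dd f x u =
     Limsup (nhds x \<times>\<^sub>F at_right (0::real)) (\<lambda>(y, s). (f (y + s *\<^sub>R u) - f y) / ereal s)"

definition clarke_subdiff :: "('a::real_inner \<Rightarrow> ereal) \<Rightarrow> 'a \<Rightarrow> 'a set" where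
  "clarke_subdiff f x = {g. \<forall>u. ereal (g \<bullet> u) \<le> clarke_dd f x u}"

text \<open>The type of the parameter space is an argument, since one cannot quantify over types inside
  a definition; a statement with hypothesis \<open>upper_C2_on TYPE('t) f X\<close> and \<open>'t\<close> free covers every
  compact parameter space (spaces that differ from point to point embed in one common type).
  \<open>G\<close> and \<open>K\<close> are the gradients and Hessians of the functions \<open>h s\<close>.\<close>

definition upper_C2_on :: "'t itself \<Rightarrow> (real^'n \<Rightarrow> ereal) \<Rightarrow> (real^'n) set \<Rightarrow> bool" where
  "upper_C2_on _ f X \<longleftrightarrow> open X \<and>
    (\<forall>z\<in>X. \<exists>U. open U \<and> z \<in> U \<and> U \<subseteq> X \<and>
      (\<exists>(T :: 't topology) (h :: 't \<Rightarrow> real^'n \<Rightarrow> real)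
          (G :: 't \<Rightarrow> real^'n \<Rightarrow> real^'n) (K :: 't \<Rightarrow> real^'n \<Rightarrow> real^'n^'n).
        compact_space T \<and>
        (\<forall>s\<in>topspace T. \<forall>x\<in>U. GDERIV (h s) x :> G s x) \<and>
        (\<forall>s\<in>topspace T. \<forall>x\<in>U. (G s has_derivative (\<lambda>u. K s x *v u)) (at x)) \<and>
        continuous_map (prod_topology T (top_of_set U)) euclidean (\<lambda>(s, x). h s x) \<and>
        continuous_map (prod_topology T (top_of_set U)) euclidean (\<lambda>(s, x). G s x) \<and>
        continuous_map (prod_topology T (top_of_set U)) euclidean (\<lambda>(s, x). K s x) \<and>
        (\<forall>x\<in>U. (\<forall>s\<in>topspace T. f x \<le> ereal (h s x)) \<and>
               (\<exists>s\<in>topspace T. f x = ereal (h s x)))))"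

definition regular_subdiff :: "('a::euclidean_space \<Rightarrow> ereal) \<Rightarrow> 'a \<Rightarrow> 'a set" where
  "regular_subdiff h x = {u. \<bar>h x\<bar> \<noteq> \<infinity> \<and>
     0 \<le> Liminf (at x) (\<lambda>y. (h y - h x - ereal (u \<bullet> (y - x))) / ereal (norm (y - x)))}"

definition limiting_subdiff :: "('a::euclidean_space \<Rightarrow> ereal) \<Rightarrow> 'a \<Rightarrow> 'a set" where
  "limiting_subdiff h x = {u. \<bar>h x\<bar> \<noteq> \<infinity> \<and>
     (\<exists>xs us. (\<forall>j::nat. us j \<in> regular_subdiff h (xs j)) \<and>
        xs \<longlonglongrightarrow> x \<and> (\<lambda>j. h (xs j)) \<longlonglongrightarrow> h x \<and> us \<longlonglongrightarrow> u)}"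

section \<open>The Kurdyka--Lojasiewicz property\<close>

definition dist_zero :: "'a::real_normed_vector set \<Rightarrow> ereal" where
  "dist_zero S = (INF u\<in>S. ereal (norm u))"

definition KL_property_at :: "('a::euclidean_space \<Rightarrow> ereal) \<Rightarrow> 'a \<Rightarrow> bool" where
  "KL_property_at h z \<longleftrightarrow>
    (\<exists>(a::ereal) U (\<phi>::real \<Rightarrow> real) \<phi>'.
       0 < a \<and> open U \<and> z \<in> U \<and>
       continuous_on {s. 0 \<le> s \<and> ereal s < a} \<phi> \<and>
       concave_on {s. 0 \<le> s \<and> ereal s < a} \<phi> \<and>
       (\<forall>s. 0 \<le> s \<and> ereal s < a \<longrightarrow> 0 \<le> \<phi> s) \<and> \<phi> 0 = 0 \<and>
       (\<forall>s. 0 < s \<and> ereal s < a \<longrightarrow> (\<phi> has_real_derivative \<phi>' s) (at s)) \<and>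
       continuous_on {s. 0 < s \<and> ereal s < a} \<phi>' \<and>
       (\<forall>s. 0 < s \<and> ereal s < a \<longrightarrow> 0 < \<phi>' s) \<and>
       (\<forall>x\<in>U. h z < h x \<and> h x < h z + a \<longrightarrow>
          1 \<le> ereal (\<phi>' (real_of_ereal (h x - h z))) * dist_zero (limiting_subdiff h x)))"

definition KL_function :: "('a::euclidean_space \<Rightarrow> ereal) \<Rightarrow> bool" where
  "KL_function h \<longleftrightarrow> (\<forall>z. limiting_subdiff h z \<noteq> {} \<longrightarrow> KL_property_at h z)"

section \<open>The constrained problem\<close>

text \<open>\<open>E\<close> and \<open>I\<close> index the equality and inequality constraints; families over these sets
  (multipliers, slacks) are functions on the whole index type, of which only the values on
  \<open>E\<close>, \<open>I\<close> or \<open>E \<union> I\<close> are ever used.\<close>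

definition feasible_set :: "'i set \<Rightarrow> 'i set \<Rightarrow> ('i \<Rightarrow> real^'n \<Rightarrow> real) \<Rightarrow> (real^'n) set" where
  "feasible_set E I c = {x. (\<forall>i\<in>E. c i x = 0) \<and> (\<forall>i\<in>I. 0 \<le> c i x)}"

definition kkt_point ::
  "(real^'n \<Rightarrow> ereal) \<Rightarrow> 'i set \<Rightarrow> 'i set \<Rightarrow> ('i \<Rightarrow> real^'n \<Rightarrow> real) \<Rightarrow> real^'n \<Rightarrow> bool" where
  "kkt_point f E I c x \<longleftrightarrow> x \<in> feasible_set E I c \<and>
     (\<exists>lam :: 'i \<Rightarrow> real.
        (\<exists>g\<in>clarke_subdiff f x. 0 = g - (\<Sum>i\<in>E \<union> I. lam i *\<^sub>R grad (c i) x)) \<and>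
        (\<forall>i\<in>I. 0 \<le> lam i \<and> lam i * c i x = 0))"

definition neg_part :: "real \<Rightarrow> real" where
  "neg_part y = max 0 (- y)"

definition violation :: "'i set \<Rightarrow> 'i set \<Rightarrow> ('i \<Rightarrow> real^'n \<Rightarrow> real) \<Rightarrow> real^'n \<Rightarrow> real" where
  "violation E I c x = (\<Sum>i\<in>E. \<bar>c i x\<bar>) + (\<Sum>i\<in>I. neg_part (c i x))"

definition merit ::
  "(real^'n \<Rightarrow> ereal) \<Rightarrow> 'i set \<Rightarrow> 'i set \<Rightarrow> ('i \<Rightarrow> real^'n \<Rightarrow> real) \<Rightarrow> real^'n \<Rightarrow> real \<Rightarrow> ereal" where
  "merit f E I c x \<theta> = f x + ereal (\<theta> * violation E I c x)"

definition active_set :: "'i set \<Rightarrow> 'i set \<Rightarrow> ('i \<Rightarrow> real^'n \<Rightarrow> real) \<Rightarrow> real^'n \<Rightarrow> 'i set" where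
  "active_set E I c x = E \<union> {i\<in>I. c i x = 0}"

text \<open>The constraint qualification is meant for feasible \<open>x\<close>; feasibility is not part of the predicate.\<close>

definition mfcq :: "'i set \<Rightarrow> 'i set \<Rightarrow> ('i \<Rightarrow> real^'n \<Rightarrow> real) \<Rightarrow> real^'n \<Rightarrow> bool" where
  "mfcq E I c x \<longleftrightarrow>
     inj_on (\<lambda>i. grad (c i) x) E \<and> independent ((\<lambda>i. grad (c i) x) ` E) \<and>
     (\<exists>u. (\<forall>i\<in>active_set E I c x \<inter> I. 0 < grad (c i) x \<bullet> u) \<and>
          (\<forall>i\<in>E. grad (c i) x \<bullet> u = 0))"

definition lin_constr :: "(real^'n \<Rightarrow> real) \<Rightarrow> real^'n \<Rightarrow> real^'n \<Rightarrow> real" where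
  "lin_constr h x w = h w + grad h w \<bullet> (x - w)"

section \<open>The SQP algorithm\<close>

text \<open>Feasible region of the subproblem at \<open>xk\<close>, in the variables \<open>x = xk + d\<close> and the slacks
  \<open>v, w, t\<close>.\<close>

definition subproblem_region ::
  "'i set \<Rightarrow> 'i set \<Rightarrow> ('i \<Rightarrow> real^'n \<Rightarrow> real) \<Rightarrow> real^'n \<Rightarrow>
   ((real^'n) \<times> ('i \<Rightarrow> real) \<times> ('i \<Rightarrow> real) \<times> ('i \<Rightarrow> real)) set" where
  "subproblem_region E I c xk = {(x, v, w, t).
     (\<forall>i\<in>E. lin_constr (c i) x xk = v i - w i) \<and>
     (\<forall>i\<in>I. lin_constr (c i) x xk \<ge> - t i) \<and>
     (\<forall>i\<in>E. 0 \<le> v i \<and> 0 \<le> w i) \<and> (\<forall>i\<in>I. 0 \<le> t i)}"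

text \<open>The slacks make every \<open>x\<close> feasible, so the projection of the region onto \<open>x\<close> is the whole space
  and is contained in no bounded set. An assumption that all these regions lie in a
  compact \<open>D\<close> therefore has to be read as one on the points of the regions that the algorithm visits:
  \<open>xk\<close> itself (\<open>d = 0\<close>) and \<open>xk + dk\<close>.\<close>

lemma subproblem_region_fst: "fst ` subproblem_region E I c xk = UNIV"
proof -
  have "x \<in> fst ` subproblem_region E I c xk" for x
    by (rule image_eqI[of _ _ "(x, \<lambda>i. max 0 (lin_constr (c i) x xk),
          \<lambda>i. max 0 (- lin_constr (c i) x xk), \<lambda>i. max 0 (- lin_constr (c i) x xk))"])
       (auto simp: subproblem_region_def max_def)
  then show ?thesis by auto
qed

definition subproblem_obj ::
  "'i set \<Rightarrow> 'i set \<Rightarrow> real \<Rightarrow> real \<Rightarrow> real^'n \<Rightarrow> real^'n^'n \<Rightarrow>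
   (real^'n) \<times> ('i \<Rightarrow> real) \<times> ('i \<Rightarrow> real) \<times> ('i \<Rightarrow> real) \<Rightarrow> real" where
  "subproblem_obj E I fk \<theta> g B = (\<lambda>(d, v, w, t).
     fk + g \<bullet> d + 1/2 * (d \<bullet> (B *v d)) + \<theta> * (\<Sum>i\<in>E. v i + w i) + \<theta> * (\<Sum>i\<in>I. t i))"

definition solves_subproblem ::
  "'i set \<Rightarrow> 'i set \<Rightarrow> ('i \<Rightarrow> real^'n \<Rightarrow> real) \<Rightarrow> real \<Rightarrow> real \<Rightarrow> real^'n \<Rightarrow> real^'n \<Rightarrow> real^'n^'n \<Rightarrow>
   (real^'n) \<times> ('i \<Rightarrow> real) \<times> ('i \<Rightarrow> real) \<times> ('i \<Rightarrow> real) \<Rightarrow> bool" where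
  "solves_subproblem E I c fk \<theta> xk g B =
     is_arg_min (subproblem_obj E I fk \<theta> g B)
       (\<lambda>(d, v, w, t). (xk + d, v, w, t) \<in> subproblem_region E I c xk)"

definition subproblem_multiplier ::
  "'i set \<Rightarrow> 'i set \<Rightarrow> ('i \<Rightarrow> real^'n \<Rightarrow> real) \<Rightarrow> real \<Rightarrow> real^'n \<Rightarrow> real^'n \<Rightarrow> real^'n^'n \<Rightarrow>
   (real^'n) \<times> ('i \<Rightarrow> real) \<times> ('i \<Rightarrow> real) \<times> ('i \<Rightarrow> real) \<Rightarrow> ('i \<Rightarrow> real) \<Rightarrow> bool" where
  "subproblem_multiplier E I c \<theta> xk g B = (\<lambda>(d, v, w, t) lam.
     g + B *v d - (\<Sum>i\<in>E \<union> I. lam i *\<^sub>R grad (c i) xk) = 0 \<and>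
     (\<forall>i\<in>I. 0 \<le> lam i \<and> lam i * (c i xk + grad (c i) xk \<bullet> d + t i) = 0) \<and>
     (\<exists>p q r :: 'i \<Rightarrow> real.
        (\<forall>i\<in>E. 0 \<le> p i \<and> 0 \<le> q i \<and> \<theta> + lam i = p i \<and> \<theta> - lam i = q i \<and>
                p i * v i = 0 \<and> q i * w i = 0) \<and>
        (\<forall>i\<in>I. 0 \<le> r i \<and> \<theta> - lam i = r i \<and> r i * t i = 0)))"

text \<open>Maximum norm of a multiplier; \<open>0\<close> if there are no constraints.\<close>

definition max_norm :: "'i set \<Rightarrow> ('i \<Rightarrow> real) \<Rightarrow> real" where
  "max_norm J lam = Max (insert 0 ((\<lambda>i. \<bar>lam i\<bar>) ` J))"

definition sufficient_decrease ::
  "(real^'n \<Rightarrow> ereal) \<Rightarrow> 'i set \<Rightarrow> 'i set \<Rightarrow> ('i \<Rightarrow> real^'n \<Rightarrow> real) \<Rightarrow> real \<Rightarrow> real \<Rightarrow>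
   real^'n \<Rightarrow> real^'n^'n \<Rightarrow> real^'n \<Rightarrow> real \<Rightarrow> bool" where
  "sufficient_decrease f E I c \<eta> \<theta> xk B d \<alpha> \<longleftrightarrow>
     merit f E I c xk \<theta> - merit f E I c (xk + \<alpha> *\<^sub>R d) \<theta> \<ge> ereal (\<eta> * \<alpha> * (1/2) * (d \<bullet> (B *v d)))"

text \<open>Infinite runs of the algorithm: the stopping test \<open>d k = 0\<close>, \<open>violation (x k) = 0\<close> never
  succeeds.\<close>

definition sqp_run ::
  "(real^'n \<Rightarrow> ereal) \<Rightarrow> 'i set \<Rightarrow> 'i set \<Rightarrow> ('i \<Rightarrow> real^'n \<Rightarrow> real) \<Rightarrow> real \<Rightarrow> real \<Rightarrow> real \<Rightarrow>
   (nat \<Rightarrow> real^'n) \<Rightarrow> (nat \<Rightarrow> real^'n) \<Rightarrow> (nat \<Rightarrow> real^'n^'n) \<Rightarrow> (nat \<Rightarrow> real^'n) \<Rightarrow>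
   (nat \<Rightarrow> 'i \<Rightarrow> real) \<Rightarrow> (nat \<Rightarrow> 'i \<Rightarrow> real) \<Rightarrow> (nat \<Rightarrow> 'i \<Rightarrow> real) \<Rightarrow> (nat \<Rightarrow> 'i \<Rightarrow> real) \<Rightarrow>
   (nat \<Rightarrow> real) \<Rightarrow> (nat \<Rightarrow> real) \<Rightarrow> bool" where
  "sqp_run f E I c \<eta> \<tau> \<gamma> x g B d v w t lam \<theta> \<alpha> \<longleftrightarrow>
     \<theta> 0 > 0 \<and>
     (\<forall>k. g k \<in> clarke_subdiff f (x k) \<and>
          transpose (B k) = B k \<and>
          solves_subproblem E I c (real_of_ereal (f (x k))) (\<theta> k) (x k) (g k) (B k)
            (d k, v k, w k, t k) \<and>
          \<not> (d k = 0 \<and> violation E I c (x k) = 0) \<and>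
          subproblem_multiplier E I c (\<theta> k) (x k) (g k) (B k) (d k, v k, w k, t k) (lam (Suc k)) \<and>
          \<theta> (Suc k) = max (\<theta> k) (max_norm (E \<union> I) (lam (Suc k)) + \<gamma>) \<and>
          (\<exists>j::nat. \<alpha> k = \<tau> ^ j \<and>
             sufficient_decrease f E I c \<eta> (\<theta> k) (x k) (B k) (d k) (\<tau> ^ j) \<and>
             (\<forall>j'<j. \<not> sufficient_decrease f E I c \<eta> (\<theta> k) (x k) (B k) (d k) (\<tau> ^ j'))) \<and>
          x (Suc k) = x k + \<alpha> k *\<^sub>R d k)"

section \<open>The potential function\<close>

definition neg_shift :: "(real^'n \<Rightarrow> ereal) \<Rightarrow> (real^'n) set \<Rightarrow> real \<Rightarrow> real^'n \<Rightarrow> ereal" where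
  "neg_shift f D \<sigma> x = (if x \<in> D then - f x + ereal (1/2 * \<sigma> * (norm x)\<^sup>2) else \<infinity>)"

text \<open>Convexity of an extended-real-valued function, via its epigraph.\<close>

definition convex_fun :: "('a::real_vector \<Rightarrow> ereal) \<Rightarrow> bool" where
  "convex_fun h \<longleftrightarrow> convex {(x, r::real). h x \<le> ereal r}"

definition conjugate :: "('a::real_inner \<Rightarrow> ereal) \<Rightarrow> 'a \<Rightarrow> ereal" where
  "conjugate h u = (SUP x. ereal (u \<bullet> x) - h x)"

definition lin_feasible_pairs ::
  "'i set \<Rightarrow> 'i set \<Rightarrow> ('i \<Rightarrow> real^'n \<Rightarrow> real) \<Rightarrow> ((real^'n) \<times> (real^'n)) set" where
  "lin_feasible_pairs E I c = {(x, w). (\<forall>i\<in>E. lin_constr (c i) x w = 0) \<and>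
                                       (\<forall>i\<in>I. 0 \<le> lin_constr (c i) x w)}"

definition potential ::
  "(real^'n \<Rightarrow> ereal) \<Rightarrow> 'i set \<Rightarrow> 'i set \<Rightarrow> ('i \<Rightarrow> real^'n \<Rightarrow> real) \<Rightarrow> (real^'n) set \<Rightarrow>
   real \<Rightarrow> real \<Rightarrow> (real^'n) \<times> (real^'n) \<times> (real^'n) \<Rightarrow> ereal" where
  "potential f E I c D \<sigma> l = (\<lambda>(x, y, w).
     ereal (- (y \<bullet> x)) + conjugate (neg_shift f D \<sigma>) y
     + ereal (1/2 * \<sigma> * (norm x)\<^sup>2) + ereal (1/2 * l * (norm (x - w))\<^sup>2)
     + (if (x, w) \<in> lin_feasible_pairs E I c then 0 else \<infinity>))"

end

theory Submission
  imports Defs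
begin

text \<open>Once the penalty parameter is constant, it exceeds the multipliers by \<open>\<gamma>\<close>, so the slacks of the
  subproblems vanish. A first-order expansion of the merit function then bounds the step sizes of the
  line search from below and shows that the merit values \<open>M\<^sub>k\<close> decrease at least by a multiple of
  \<open>\<parallel>d\<^sub>k\<parallel>\<^sup>2 + e\<^sub>k\<close>, where \<open>e\<^sub>k \<ge> 0\<close> measures the first-order decrease due to the constraints.
  At \<open>z\<^sub>k = (x\<^sub>k + d\<^sub>k, \<sigma> x\<^sub>k - g\<^sub>k, x\<^sub>k)\<close> the potential has the value
  \<open>f(x\<^sub>k) + g\<^sub>k \<bullet> d\<^sub>k + (\<sigma> + l)/2 \<parallel>d\<^sub>k\<parallel>\<^sup>2\<close> and a subgradient of norm \<open>O(\<parallel>d\<^sub>k\<parallel>)\<close>. These values need not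
  decrease, because the step sizes may stay below \<open>1\<close>, but they lie below \<open>M\<^sub>k\<close> by at most a multiple of
  \<open>M\<^sub>k - M\<^sub>k\<^sub>+\<^sub>1\<close>. This is enough to apply the Kurdyka--Lojasiewicz inequality, made uniform over the
  cluster points of \<open>z\<^sub>k\<close>, to the decreasing sequence \<open>M\<^sub>k\<close>, which gives \<open>\<Sum>\<parallel>d\<^sub>k\<parallel> < \<infinity>\<close>. Since the multipliers are
  bounded, the optimality conditions of the subproblems pass to the limit.\<close>

subsection \<open>Subdifferentials\<close>

text \<open>Test the defining inequality in the direction \<open>g\<close> itself: near
  \<open>z\<close> the difference quotients in this direction are at most
  \<open>Lip * norm g\<close>.\<close>

lemma clarke_subdiff_norm_le:
  fixes f :: "'a::real_inner \<Rightarrow> ereal"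
  assumes "open X" "z \<in> X" and fin: "\<And>y. y \<in> X \<Longrightarrow> f y = ereal (h y)"
    and lip: "Lip-lipschitz_on X h" and g: "g \<in> clarke_subdiff f z"
  shows "norm g \<le> Lip"
proof -
  let ?F = "nhds z \<times>\<^sub>F at_right (0::real)"
  have lim: "filterlim (\<lambda>p. fst p + snd p *\<^sub>R g) (nhds z) ?F"
  proof -
    have s: "filterlim snd (nhds 0) ?F"
      using filterlim_snd[of "at_right (0::real)" "nhds z"]
      by (rule filterlim_mono) (auto simp: at_within_def)
    show ?thesis
      using tendsto_add[OF filterlim_fst tendsto_scaleR[OF s tendsto_const[of g]]] by simp
  qed
  have 1: "\<forall>\<^sub>F p in ?F. fst p \<in> X"
    using topological_tendstoD[OF filterlim_fst assms(1,2)] .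
  have 2: "\<forall>\<^sub>F p in ?F. fst p + snd p *\<^sub>R g \<in> X"
    using topological_tendstoD[OF lim assms(1,2)] .
  have 3: "\<forall>\<^sub>F p in ?F. snd p > 0"
    using filterlim_snd[of "at_right (0::real)" "nhds z"]
    by (rule eventually_compose_filterlim[rotated]) (simp add: eventually_at_right_less)
  have "clarke_dd f z g \<le> ereal (Lip * norm g)"
    unfolding clarke_dd_def
  proof (rule Limsup_bounded, use 1 2 3 in eventually_elim)
    fix p assume p: "fst p \<in> X" "fst p + snd p *\<^sub>R g \<in> X" "snd p > 0"
    have "h (fst p + snd p *\<^sub>R g) - h (fst p) \<le> Lip * norm (snd p *\<^sub>R g)"
      using lipschitz_onD[OF lip p(2,1)] by (simp add: dist_norm)
    then have "(h (fst p + snd p *\<^sub>R g) - h (fst p)) / snd p \<le> Lip * norm g"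
      using p(3) by (simp add: field_simps)
    then show "(case p of (y, s) \<Rightarrow> (f (y + s *\<^sub>R g) - f y) / ereal s) \<le> ereal (Lip * norm g)"
      using p by (cases p) (auto simp: fin)
  qed
  moreover have "ereal (g \<bullet> g) \<le> clarke_dd f z g"
    using g by (auto simp: clarke_subdiff_def)
  ultimately have "ereal (g \<bullet> g) \<le> ereal (Lip * norm g)" by (rule order_trans[rotated])
  then have "g \<bullet> g \<le> Lip * norm g" by simp
  then have "norm g * norm g \<le> Lip * norm g" by (simp add: power2_eq_square flip: power2_norm_eq_inner)
  then show ?thesis
    using lipschitz_on_nonneg[OF lip] by (cases "g = 0") auto
qed

text \<open>The \<open>Limsup\<close> in \<open>clarke_dd\<close> runs over moving base points, so a
  bound on the quotients near \<open>z\<close> also holds near every \<open>x k\<close> close to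
  \<open>z\<close>. This upper semicontinuity makes the graph of the subdifferential closed.\<close>

lemma clarke_subdiff_closed:
  fixes f :: "'a::real_inner \<Rightarrow> ereal"
  assumes x: "x \<longlonglongrightarrow> z" and g: "g \<longlonglongrightarrow> g0" and mem: "\<And>k::nat. g k \<in> clarke_subdiff f (x k)"
  shows "g0 \<in> clarke_subdiff f z"
  unfolding clarke_subdiff_def
proof (intro CollectI allI)
  fix u
  let ?q = "\<lambda>(y, s). (f (y + s *\<^sub>R u) - f y) / ereal s"
  show "ereal (g0 \<bullet> u) \<le> clarke_dd f z u"
  proof (rule dense_ge)
    fix r assume "clarke_dd f z u < r"
    then have "\<forall>\<^sub>F p in nhds z \<times>\<^sub>F at_right 0. ?q p < r"
      unfolding clarke_dd_def by (rule Limsup_lessD)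
    then obtain P Q where PQ: "eventually P (nhds z)" "eventually Q (at_right 0)"
      "\<And>y s. P y \<Longrightarrow> Q s \<Longrightarrow> ?q (y, s) < r"
      by (auto simp: eventually_prod_filter)
    have "\<forall>\<^sub>F y in nhds z. eventually P (nhds y)"
      using PQ(1) by (simp add: eventually_eventually)
    then have "\<forall>\<^sub>F k in sequentially. eventually P (nhds (x k))"
      using x eventually_compose_filterlim by blast
    then have "\<forall>\<^sub>F k in sequentially. ereal (g k \<bullet> u) \<le> r"
    proof eventually_elim
      fix k assume "eventually P (nhds (x k))"
      then have "\<forall>\<^sub>F p in nhds (x k) \<times>\<^sub>F at_right 0. ?q p \<le> r"
        using PQ(2,3) unfolding eventually_prod_filter by (blast intro: less_imp_le)
      then have "clarke_dd f (x k) u \<le> r"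
        unfolding clarke_dd_def by (rule Limsup_bounded)
      then show "ereal (g k \<bullet> u) \<le> r"
        using mem[of k] unfolding clarke_subdiff_def by (blast intro: order_trans)
    qed
    moreover have "(\<lambda>k. ereal (g k \<bullet> u)) \<longlonglongrightarrow> ereal (g0 \<bullet> u)"
      using g by (intro tendsto_intros)
    ultimately show "ereal (g0 \<bullet> u) \<le> r"
      by (intro tendsto_upperbound[of _ _ sequentially]) auto
  qed
qed

text \<open>The difference quotient of \<open>h\<close> dominates that of the smooth minorant
  \<open>S\<close>, and the latter tends to 0.\<close>

lemma regular_subdiffI:
  fixes h :: "'a::euclidean_space \<Rightarrow> ereal"
  assumes minor: "\<And>y. ereal (S y) \<le> h y" and touch: "h z = ereal (S z)"
    and der: "GDERIV S z :> u"
  shows "u \<in> regular_subdiff h z"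
proof -
  let ?q = "\<lambda>y. (S y - S z - u \<bullet> (y - z)) / norm (y - z)"
  have "(?q \<longlongrightarrow> 0) (at z)"
    using der unfolding gderiv_def has_derivative_iff_norm
    by (subst tendsto_norm_zero_iff[symmetric]) (simp add: inner_commute)
  then have "((\<lambda>y. ereal (?q y)) \<longlongrightarrow> ereal 0) (at z)" by (simp only: tendsto_ereal)
  then have "Liminf (at z) (\<lambda>y. ereal (?q y)) = 0"
    by (simp add: lim_imp_Liminf zero_ereal_def)
  moreover have "Liminf (at z) (\<lambda>y. ereal (?q y))
      \<le> Liminf (at z) (\<lambda>y. (h y - h z - ereal (u \<bullet> (y - z))) / ereal (norm (y - z)))"
  proof (rule Liminf_mono, unfold eventually_at_filter, intro always_eventually allI impI)
    fix y assume "y \<noteq> z"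
    then have "0 < norm (y - z)" by simp
    then show "ereal (?q y) \<le> (h y - h z - ereal (u \<bullet> (y - z))) / ereal (norm (y - z))"
      using minor[of y] touch
      by (cases "h y") (auto intro!: divide_right_mono)
  qed
  ultimately show ?thesis by (simp add: regular_subdiff_def touch)
qed

lemma regular_subset_limiting_subdiff: "regular_subdiff h z \<subseteq> limiting_subdiff h z"
proof
  fix u assume u: "u \<in> regular_subdiff h z"
  then have "\<exists>xs us. (\<forall>j::nat. us j \<in> regular_subdiff h (xs j)) \<and>
        xs \<longlonglongrightarrow> z \<and> (\<lambda>j. h (xs j)) \<longlonglongrightarrow> h z \<and> us \<longlonglongrightarrow> u"
    by (intro exI[of _ "\<lambda>_. z"] exI[of _ "\<lambda>_. u"]) auto
  then show "u \<in> limiting_subdiff h z"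
    using u by (auto simp: limiting_subdiff_def regular_subdiff_def)
qed

text \<open>The equality case of the Fenchel-Young inequality: \<open>y\<close> is a subgradient of
  \<open>h\<close> at \<open>z\<close>, so the supremum is attained at \<open>z\<close>.\<close>

lemma conjugate_eq:
  assumes "\<And>z'. ereal (F z + y \<bullet> (z' - z)) \<le> h z'" "h z = ereal (F z)"
  shows "conjugate h y = ereal (y \<bullet> z - F z)"
  unfolding conjugate_def
proof (rule antisym)
  show "(SUP x. ereal (y \<bullet> x) - h x) \<le> ereal (y \<bullet> z - F z)"
  proof (rule SUP_least)
    fix x
    show "ereal (y \<bullet> x) - h x \<le> ereal (y \<bullet> z - F z)"
      using assms(1)[of x] by (cases "h x") (auto simp: inner_diff_right)
  qed
  show "ereal (y \<bullet> z - F z) \<le> (SUP x. ereal (y \<bullet> x) - h x)"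
    by (rule SUP_upper2[of z]) (auto simp: assms(2))
qed

subsection \<open>Desingularization\<close>

lemma concave_on_le_tangent:
  fixes \<phi> :: "real \<Rightarrow> real"
  assumes "concave_on S \<phi>" "x \<in> interior S" "y \<in> S"
    and der: "(\<phi> has_real_derivative D) (at x)"
  shows "\<phi> y \<le> \<phi> x + D * (y - x)"
proof -
  have "convex_on S (\<lambda>s. - \<phi> s)" using assms(1) by (simp add: concave_on_def)
  moreover have "connected S"
    using assms(1) by (simp add: concave_on_iff convex_connected)
  moreover have "((\<lambda>s. - \<phi> s) has_real_derivative - D) (at x within S)"
    using der by (auto intro: DERIV_minus DERIV_subset)
  ultimately have "- \<phi> y - - \<phi> x \<ge> - D * (y - x)"
    using assms(2,3) by (intro convex_on_imp_above_tangent)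
  then show ?thesis by (simp add: algebra_simps)
qed

text \<open>If \<open>L k - M0\<close> is less than half of \<open>M k - M0\<close>, then the gap hypothesis yields a linear
  contraction of \<open>M - M0\<close>, and the square root takes over the role of the functions \<open>\<phi> j\<close>.\<close>

lemma KL_summable:
  fixes M L \<delta> :: "nat \<Rightarrow> real" and \<phi> \<phi>' :: "'j \<Rightarrow> real \<Rightarrow> real"
  assumes "finite J" "a > 0"
    and concave: "\<And>j. j \<in> J \<Longrightarrow> concave_on {0..<a} (\<phi> j)"
    and nonneg: "\<And>j s. j \<in> J \<Longrightarrow> 0 \<le> s \<Longrightarrow> s < a \<Longrightarrow> 0 \<le> \<phi> j s"
    and der: "\<And>j s. j \<in> J \<Longrightarrow> 0 < s \<Longrightarrow> s < a \<Longrightarrow> (\<phi> j has_real_derivative \<phi>' j s) (at s)"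
    and pos: "\<And>j s. j \<in> J \<Longrightarrow> 0 < s \<Longrightarrow> s < a \<Longrightarrow> 0 < \<phi>' j s"
    and \<delta>: "\<And>k. 0 \<le> \<delta> k"
    and M: "M \<longlonglongrightarrow> M0" and L: "L \<longlonglongrightarrow> M0"
    and "\<kappa> > 0" "C > 0" "R > 0"
    and decrease: "\<And>k. \<kappa> * (\<delta> k)\<^sup>2 \<le> M k - M (Suc k)"
    and gap: "\<And>k. M k - L k \<le> C * (M k - M (Suc k))"
    and KL: "\<forall>\<^sub>F k in sequentially. M0 < L k \<longrightarrow> (\<exists>j\<in>J. 1 \<le> \<phi>' j (L k - M0) * (R * \<delta> k))"
  shows "summable \<delta>"
proof -
  define s where "s k = M k - M0" for k
  have drop: "0 \<le> s k - s (Suc k)" "\<kappa> * (\<delta> k)\<^sup>2 \<le> s k - s (Suc k)" for k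
  proof -
    have "0 \<le> \<kappa> * (\<delta> k)\<^sup>2" using \<open>\<kappa> > 0\<close> by simp
    then show "0 \<le> s k - s (Suc k)" "\<kappa> * (\<delta> k)\<^sup>2 \<le> s k - s (Suc k)"
      using decrease[of k] by (auto simp: s_def)
  qed
  have "decseq s" using drop(1) by (simp add: decseq_Suc_iff)
  have s0: "s \<longlonglongrightarrow> 0" using M unfolding s_def by (simp add: LIM_zero)
  have s_nonneg: "0 \<le> s k" for k using decseq_ge[OF \<open>decseq s\<close> s0] .
  show ?thesis
  \<comment> \<open>The functions \<open>\<phi> j\<close> are differentiable only at positive
    arguments. If \<open>s\<close> ever reaches 0, it stays there, and \<open>\<delta>\<close>
    vanishes from then on.\<close>
  proof (cases "\<exists>m. s m = 0")
    case True
    then obtain m where m: "s m = 0" by blast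
    have "\<delta> k = 0" if "k \<ge> m" for k
    proof -
      have "s k = 0" "s (Suc k) = 0"
        using decseqD[OF \<open>decseq s\<close>] m s_nonneg that by (metis le_SucI order_antisym)+
      then have "\<kappa> * (\<delta> k)\<^sup>2 \<le> 0" using drop(2)[of k] by simp
      then show ?thesis using \<open>\<kappa> > 0\<close> by (simp add: mult_le_0_iff)
    qed
    then show ?thesis by (intro summable_finite[of "{..<m}"]) auto
  next
    case False
    then have s_pos: "0 < s k" for k using s_nonneg[of k] by (metis order_le_less)
    have "\<forall>\<^sub>F k in sequentially. s k < a"
      using order_tendstoD(2)[OF s0 \<open>a > 0\<close>] .
    moreover have "\<forall>\<^sub>F k in sequentially. L k < M0 + a"
      using order_tendstoD(2)[OF L, of "M0 + a"] \<open>a > 0\<close> by simp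
    ultimately have "\<forall>\<^sub>F k in sequentially. s k < a \<and> L k < M0 + a \<and>
        (M0 < L k \<longrightarrow> (\<exists>j\<in>J. 1 \<le> \<phi>' j (L k - M0) * (R * \<delta> k)))"
      using KL by eventually_elim blast
    then obtain N where N: "\<And>k. k \<ge> N \<Longrightarrow> s k < a" "\<And>k. k \<ge> N \<Longrightarrow> L k < M0 + a"
      "\<And>k. k \<ge> N \<Longrightarrow> M0 < L k \<Longrightarrow> \<exists>j\<in>J. 1 \<le> \<phi>' j (L k - M0) * (R * \<delta> k)"
      unfolding eventually_sequentially by blast
    \<comment> \<open>The index \<open>j\<close> given by \<open>KL\<close> may change with
      \<open>k\<close>. Summing over all \<open>j\<close> removes this dependence: each summand is
      nonincreasing in \<open>k\<close>, so the sum drops at least as much as any single one. The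
      argument is half of \<open>s k\<close> because the first case below has
      \<open>L k - M0 \<ge> s k / 2\<close>.\<close>
    define \<Psi> where "\<Psi> k = (\<Sum>j\<in>J. \<phi> j (s k / 2))" for k
    define \<Phi> where "\<Phi> k = \<Psi> k + sqrt (s k)" for k
    define Q where "Q = max (2 * R / \<kappa>) (2 * sqrt (2 * C) / sqrt \<kappa>)"
    have "Q > 0" using \<open>R > 0\<close> \<open>\<kappa> > 0\<close> by (simp add: Q_def less_max_iff_disj)
    have \<phi>_drop: "\<phi>' j (s k / 2) * ((s k - s (Suc k)) / 2) \<le> \<phi> j (s k / 2) - \<phi> j (s (Suc k) / 2)"
      if "j \<in> J" "k \<ge> N" for j k
    proof -
      have "s k / 2 < a" "s (Suc k) / 2 < a"
        using N(1)[of k] N(1)[of "Suc k"] that s_pos[of k] s_pos[of "Suc k"] by auto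
      then have "\<phi> j (s (Suc k) / 2) \<le> \<phi> j (s k / 2) + \<phi>' j (s k / 2) * (s (Suc k) / 2 - s k / 2)"
        using s_pos[of k] s_pos[of "Suc k"] that
        by (intro concave_on_le_tangent[OF concave _ _ der]) auto
      then show ?thesis by (simp add: field_simps)
    qed
    have \<phi>_mono: "0 \<le> \<phi> j (s k / 2) - \<phi> j (s (Suc k) / 2)" if "j \<in> J" "k \<ge> N" for j k
    proof -
      have "0 < \<phi>' j (s k / 2)"
        using pos[OF that(1), of "s k / 2"] s_pos[of k] N(1)[OF that(2)] by simp
      then have "0 \<le> \<phi>' j (s k / 2) * ((s k - s (Suc k)) / 2)"
        using drop(1)[of k] by simp
      then show ?thesis using \<phi>_drop[OF that] by linarith
    qed
    have \<Psi>_mono: "0 \<le> \<Psi> k - \<Psi> (Suc k)" if "k \<ge> N" for k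
      unfolding \<Psi>_def using \<phi>_mono that by (simp flip: sum_subtractf add: sum_nonneg)
    have sqrt_mono: "0 \<le> sqrt (s k) - sqrt (s (Suc k))" for k
      using drop(1)[of k] by simp
    have \<Phi>_drop: "\<Psi> k - \<Psi> (Suc k) \<le> \<Phi> k - \<Phi> (Suc k)"
      "sqrt (s k) - sqrt (s (Suc k)) \<le> \<Phi> k - \<Phi> (Suc k)" "0 \<le> \<Phi> k - \<Phi> (Suc k)"
      if "k \<ge> N" for k
      using \<Psi>_mono[OF that] sqrt_mono[of k] unfolding \<Phi>_def by linarith+
    have step: "\<delta> k \<le> Q * (\<Phi> k - \<Phi> (Suc k))" if k: "k \<ge> N" for k
    proof (cases "s k / 2 \<le> L k - M0")
      case True
      then have "M0 < L k" using s_pos[of k] by linarith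
      then obtain j where j: "j \<in> J" "1 \<le> \<phi>' j (L k - M0) * (R * \<delta> k)"
        using N(3)[OF k] by blast
      let ?u = "L k - M0" and ?w = "s k / 2"
      have range: "0 < ?w" "?w < a" "0 < ?u" "?u < a"
        using s_pos[of k] N(1,2)[OF k] \<open>M0 < L k\<close> by auto
      \<comment> \<open>The derivative of a concave function is antitone; this follows by adding the
        tangent inequalities at \<open>?u\<close> and \<open>?w\<close>. It moves the inequality
        from \<open>L k - M0\<close> to \<open>s k / 2\<close>.\<close>
      have "\<phi>' j ?u \<le> \<phi>' j ?w"
      proof (cases "?u = ?w")
        case False
        have "\<phi> j ?u \<le> \<phi> j ?w + \<phi>' j ?w * (?u - ?w)" "\<phi> j ?w \<le> \<phi> j ?u + \<phi>' j ?u * (?w - ?u)"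
          using range j(1) by (intro concave_on_le_tangent[OF concave _ _ der]; simp)+
        then have "0 \<le> (\<phi>' j ?w - \<phi>' j ?u) * (?u - ?w)" by (simp add: algebra_simps)
        then show ?thesis using True False by (simp add: zero_le_mult_iff)
      next
        case True
        show ?thesis unfolding True ..
      qed
      then have "1 \<le> \<phi>' j ?w * (R * \<delta> k)"
        using j(2) \<delta>[of k] \<open>R > 0\<close> by (meson mult_right_mono mult_nonneg_nonneg less_imp_le order_trans)
      \<comment> \<open>Multiplying by \<open>\<kappa> * \<delta> k\<close> produces the square that
        the decrease of \<open>s\<close> controls.\<close>
      then have "\<delta> k * \<kappa> * 1 \<le> \<delta> k * \<kappa> * (\<phi>' j ?w * (R * \<delta> k))"
        using \<delta>[of k] \<open>\<kappa> > 0\<close> by (intro mult_left_mono) auto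
      also have "\<dots> = R * \<phi>' j ?w * (\<kappa> * (\<delta> k)\<^sup>2)" by (simp add: power2_eq_square)
      also have "\<dots> \<le> R * \<phi>' j ?w * (s k - s (Suc k))"
        using drop(2)[of k] \<open>R > 0\<close> pos[OF j(1) range(1,2)] by (intro mult_left_mono) auto
      also have "\<dots> = 2 * R * (\<phi>' j ?w * ((s k - s (Suc k)) / 2))" by simp
      also have "\<dots> \<le> 2 * R * (\<phi> j ?w - \<phi> j (s (Suc k) / 2))"
        using \<phi>_drop[OF j(1) k] \<open>R > 0\<close> by (intro mult_left_mono) auto
      also have "\<phi> j ?w - \<phi> j (s (Suc k) / 2) \<le> \<Psi> k - \<Psi> (Suc k)"
        unfolding \<Psi>_def sum_subtractf[symmetric]
        using \<phi>_mono k j(1) \<open>finite J\<close>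
        by (intro member_le_sum[where f = "\<lambda>j. \<phi> j (s k / 2) - \<phi> j (s (Suc k) / 2)"]) auto
      also have "\<Psi> k - \<Psi> (Suc k) \<le> \<Phi> k - \<Phi> (Suc k)"
        using \<Phi>_drop[OF k] by simp
      finally have "\<delta> k * \<kappa> \<le> 2 * R * (\<Phi> k - \<Phi> (Suc k))" using \<open>R > 0\<close> by simp
      then have "\<delta> k \<le> 2 * R / \<kappa> * (\<Phi> k - \<Phi> (Suc k))" using \<open>\<kappa> > 0\<close> by (simp add: field_simps)
      also have "\<dots> \<le> Q * (\<Phi> k - \<Phi> (Suc k))"
        using \<Phi>_drop(3)[OF k] by (intro mult_right_mono) (auto simp: Q_def)
      finally show ?thesis .
    next
      case False
      then have "s k \<le> 2 * (M k - L k)" by (simp add: s_def field_simps)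
      also have "\<dots> \<le> 2 * (C * (M k - M (Suc k)))" using gap[of k] by simp
      finally have sk: "s k \<le> 2 * C * (s k - s (Suc k))" by (simp add: s_def)
      define y where "y = s k - s (Suc k)"
      have "y \<noteq> 0" using sk s_pos[of k] by (auto simp: y_def)
      then have "0 < y" using drop(1)[of k] by (simp add: y_def)
      have r: "sqrt (s k) \<le> sqrt (2 * C) * sqrt y"
        using sk by (simp add: y_def flip: real_sqrt_mult)
      have "sqrt \<kappa> * \<delta> k = sqrt (\<kappa> * (\<delta> k)\<^sup>2)" using \<delta>[of k] by (simp add: real_sqrt_mult)
      also have "\<dots> \<le> sqrt y" using drop(2)[of k] by (simp add: y_def)
      also have "\<dots> \<le> 2 * sqrt (2 * C) * (sqrt (s k) - sqrt (s (Suc k)))"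
      proof -
        \<comment> \<open>Factor a difference of squares. Both roots in the second factor are at
          most \<open>sqrt (2 * C) * sqrt y\<close>, so one \<open>sqrt y\<close> cancels.\<close>
        have "sqrt y * sqrt y = (sqrt (s k) - sqrt (s (Suc k))) * (sqrt (s k) + sqrt (s (Suc k)))"
          using \<open>0 < y\<close> s_nonneg[of k] s_nonneg[of "Suc k"] by (simp add: algebra_simps y_def)
        also have "\<dots> \<le> (sqrt (s k) - sqrt (s (Suc k))) * (2 * (sqrt (2 * C) * sqrt y))"
          using sqrt_mono[of k] r by (intro mult_left_mono) linarith+
        finally have "sqrt y * sqrt y \<le> sqrt y * (2 * sqrt (2 * C) * (sqrt (s k) - sqrt (s (Suc k))))"
          by (simp add: mult_ac)
        then show ?thesis by (rule mult_left_le_imp_le) (use \<open>0 < y\<close> in simp)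
      qed
      also have "\<dots> \<le> 2 * sqrt (2 * C) * (\<Phi> k - \<Phi> (Suc k))"
        using \<Phi>_drop(2)[OF k] \<open>C > 0\<close> by (intro mult_left_mono) auto
      finally have "\<delta> k \<le> 2 * sqrt (2 * C) / sqrt \<kappa> * (\<Phi> k - \<Phi> (Suc k))"
        using \<open>\<kappa> > 0\<close> by (simp add: field_simps)
      also have "\<dots> \<le> Q * (\<Phi> k - \<Phi> (Suc k))"
        using \<Phi>_drop(3)[OF k] by (intro mult_right_mono) (auto simp: Q_def)
      finally show ?thesis .
    qed
    have \<Phi>_nonneg: "0 \<le> \<Phi> k" if "k \<ge> N" for k
    proof -
      have "0 \<le> \<Psi> k" unfolding \<Psi>_def
        using nonneg s_pos[of k] N(1)[OF that] by (intro sum_nonneg) auto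
      then show ?thesis using s_pos[of k] by (simp add: \<Phi>_def)
    qed
    have "summable (\<lambda>k. \<delta> (k + N))"
    proof (rule bounded_imp_summable)
      fix n
      have "(\<Sum>k\<le>n. \<delta> (k + N)) \<le> (\<Sum>k\<le>n. Q * (\<Phi> (k + N) - \<Phi> (Suc k + N)))"
        using step by (intro sum_mono) simp
      also have "\<dots> = Q * (\<Phi> N - \<Phi> (Suc n + N))"
        using sum_telescope[of "\<lambda>k. \<Phi> (k + N)" n] by (simp add: sum_distrib_left[symmetric])
      also have "\<dots> \<le> Q * \<Phi> N"
        using \<Phi>_nonneg[of "Suc n + N"] \<open>Q > 0\<close> by simp
      finally show "(\<Sum>k\<le>n. \<delta> (k + N)) \<le> Q * \<Phi> N" .
    qed (rule \<delta>)
    then show ?thesis by (simp add: summable_iff_shift)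
  qed
qed

text \<open>A point of \<open>S\<close> that is not a cluster point has a neighbourhood that the
  sequence eventually avoids. Cover \<open>S\<close> by these neighbourhoods and the sets
  \<open>U p\<close>; in a finite subcover only the \<open>U p\<close> remain for late
  indices.\<close>

lemma eventually_in_cluster_neighbourhoods:
  fixes z :: "nat \<Rightarrow> 'a::metric_space"
  assumes "compact S" and z: "\<And>k. z k \<in> S"
    and U: "\<And>p r. strict_mono r \<Longrightarrow> (z \<circ> r) \<longlonglongrightarrow> p \<Longrightarrow> open (U p) \<and> p \<in> U p"
  obtains P where "finite P" "\<And>p. p \<in> P \<Longrightarrow> \<exists>r. strict_mono r \<and> (z \<circ> r) \<longlonglongrightarrow> p"
    "\<forall>\<^sub>F k in sequentially. \<exists>p\<in>P. z k \<in> U p"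
proof -
  define A where "A = {p. \<exists>r. strict_mono r \<and> (z \<circ> r) \<longlonglongrightarrow> p}"
  have "\<exists>V. open V \<and> p \<in> V \<and> (\<forall>\<^sub>F k in sequentially. z k \<notin> V)" if "p \<notin> A" for p
  proof (rule ccontr)
    assume no: "\<not> ?thesis"
    \<comment> \<open>Without such a neighbourhood every ball around \<open>p\<close> is visited
      infinitely often, and dependent choice extracts a subsequence converging to
      \<open>p\<close>.\<close>
    have ex: "\<exists>k>m. dist (z k) p < inverse (real (Suc n))" for m n
    proof -
      have "\<not> (\<forall>\<^sub>F k in sequentially. z k \<notin> ball p (inverse (real (Suc n))))"
      proof
        assume "\<forall>\<^sub>F k in sequentially. z k \<notin> ball p (inverse (real (Suc n)))"
        then have "\<exists>V. open V \<and> p \<in> V \<and> (\<forall>\<^sub>F k in sequentially. z k \<notin> V)"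
          by (intro exI[of _ "ball p (inverse (real (Suc n)))"]) simp
        then show False using no by contradiction
      qed
      then obtain k where "k \<ge> Suc m" "z k \<in> ball p (inverse (real (Suc n)))"
        unfolding eventually_sequentially by blast
      then show ?thesis by (intro exI[of _ k]) (auto simp: dist_commute)
    qed
    have "\<exists>r. \<forall>n. dist (z (r n)) p < inverse (real (Suc n)) \<and> r n < r (Suc n)"
    proof (rule dependent_nat_choice)
      show "\<exists>k. dist (z k) p < inverse (real (Suc 0))" using ex[of 0 0] by blast
      show "\<exists>k'. dist (z k') p < inverse (real (Suc (Suc n))) \<and> k < k'" for k n
        using ex[of k "Suc n"] by blast
    qed
    then obtain r where r: "\<And>n. dist (z (r n)) p < inverse (real (Suc n))" "\<And>n. r n < r (Suc n)"
      by blast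
    have "(\<lambda>n. dist (z (r n)) p) \<longlonglongrightarrow> 0"
    proof (rule tendsto_sandwich[OF _ _ tendsto_const LIMSEQ_inverse_real_of_nat])
      show "\<forall>\<^sub>F n in sequentially. dist (z (r n)) p \<le> inverse (real (Suc n))"
        by (rule always_eventually) (rule allI, rule less_imp_le, rule r(1))
    qed simp
    then have "(z \<circ> r) \<longlonglongrightarrow> p" by (subst tendsto_dist_iff) (simp add: o_def)
    moreover have "strict_mono r" using r(2) by (simp add: strict_mono_Suc_iff)
    ultimately show False using that by (auto simp: A_def)
  qed
  then obtain V where V: "\<And>p. p \<notin> A \<Longrightarrow> open (V p) \<and> p \<in> V p \<and> (\<forall>\<^sub>F k in sequentially. z k \<notin> V p)"
    by metis
  define W where "W p = (if p \<in> A then U p else V p)" for p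
  have W: "open (W p)" "p \<in> W p" for p using U V by (auto simp: W_def A_def)
  obtain Q where Q: "Q \<subseteq> S" "finite Q" "S \<subseteq> (\<Union>p\<in>Q. W p)"
    by (rule compactE_image[OF \<open>compact S\<close>, of S W]) (use W in auto)
  have "\<forall>\<^sub>F k in sequentially. \<forall>p\<in>Q - A. z k \<notin> V p"
    using Q(2) V by (intro eventually_ball_finite) auto
  then have "\<forall>\<^sub>F k in sequentially. \<exists>p\<in>Q \<inter> A. z k \<in> U p"
  proof eventually_elim
    case (elim k)
    then show ?case using Q(3) z[of k] by (auto simp: W_def split: if_splits)
  qed
  moreover have "\<exists>r. strict_mono r \<and> (z \<circ> r) \<longlonglongrightarrow> p" if "p \<in> Q \<inter> A" for p
    using that by (simp add: A_def)
  ultimately show thesis using that[of "Q \<inter> A"] Q(2) by blast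
qed

text \<open>A passage to real arithmetic: the possibly infinite \<open>a\<close> is replaced by a
  smaller positive real, and the distance of 0 to the subdifferential by the norm of an arbitrary
  subgradient.\<close>

lemma KL_property_atE:
  assumes "KL_property_at L p" and p: "L p = ereal M0"
  obtains a U \<phi> \<phi>' where "a > 0" "open U" "p \<in> U" "concave_on {0..<a} \<phi>"
    "\<And>s. 0 \<le> s \<Longrightarrow> s < a \<Longrightarrow> 0 \<le> \<phi> s"
    "\<And>s. 0 < s \<Longrightarrow> s < a \<Longrightarrow> (\<phi> has_real_derivative \<phi>' s) (at s)"
    "\<And>s. 0 < s \<Longrightarrow> s < a \<Longrightarrow> 0 < \<phi>' s"
    "\<And>z y u. z \<in> U \<Longrightarrow> L z = ereal y \<Longrightarrow> M0 < y \<Longrightarrow> y < M0 + a \<Longrightarrow> u \<in> limiting_subdiff L z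
      \<Longrightarrow> 1 \<le> \<phi>' (y - M0) * norm u"
  using assms(1) unfolding KL_property_at_def
proof (elim exE conjE)
  fix a U \<phi> \<phi>'
  assume "0 < a" "open U" "p \<in> U"
    and concave: "concave_on {s. 0 \<le> s \<and> ereal s < a} \<phi>"
    and nonneg: "\<forall>s. 0 \<le> s \<and> ereal s < a \<longrightarrow> 0 \<le> \<phi> s"
    and der: "\<forall>s. 0 < s \<and> ereal s < a \<longrightarrow> (\<phi> has_real_derivative \<phi>' s) (at s)"
    and pos: "\<forall>s. 0 < s \<and> ereal s < a \<longrightarrow> 0 < \<phi>' s"
    and KL: "\<forall>z\<in>U. L p < L z \<and> L z < L p + a \<longrightarrow>
      1 \<le> ereal (\<phi>' (real_of_ereal (L z - L p))) * dist_zero (limiting_subdiff L z)"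
  obtain a' where "0 < ereal a'" and a': "ereal a' < a" using ereal_dense2[OF \<open>0 < a\<close>] by blast
  then have "0 < a'" by simp
  have lt: "ereal s < a" if "s < a'" for s
    using less_trans[of "ereal s" "ereal a'" a] a' that by simp
  show thesis
  proof
    show "concave_on {0..<a'} \<phi>"
      using concave lt unfolding concave_on_def by (elim convex_on_subset) auto
    show "1 \<le> \<phi>' (y - M0) * norm u"
      if "z \<in> U" "L z = ereal y" "M0 < y" "y < M0 + a'" "u \<in> limiting_subdiff L z" for z y u
    proof -
      have less: "ereal (y - M0) < a" using that lt by simp
      have "L z < L p + a" using less that p by (cases a) auto
      then have "1 \<le> ereal (\<phi>' (y - M0)) * dist_zero (limiting_subdiff L z)"
        using KL[rule_format, OF that(1)] that p by simp
      also have "\<dots> \<le> ereal (\<phi>' (y - M0)) * ereal (norm u)"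
        using pos[rule_format, of "y - M0"] less that unfolding dist_zero_def
        by (intro ereal_mult_left_mono INF_lower) auto
      finally show ?thesis by (simp add: one_ereal_def)
    qed
    show "0 \<le> \<phi> s" if "0 \<le> s" "s < a'" for s
      using nonneg lt that by blast
    show "(\<phi> has_real_derivative \<phi>' s) (at s)" "0 < \<phi>' s" if "0 < s" "s < a'" for s
      using der pos lt that by blast+
  qed fact+
qed

text \<open>Each cluster point brings its own neighbourhood and desingularizing function; by
  compactness finitely many of them serve all late indices, which is the situation of
  \<open>KL_summable\<close>. The assumption \<open>cluster\<close> takes the place of continuity of
  \<open>L\<close>.\<close>

lemma KL_function_summable:
  fixes z u :: "nat \<Rightarrow> 'a::euclidean_space"
  assumes KL: "KL_function L" and "compact S" "\<And>k. z k \<in> S"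
    and L: "\<And>k. L (z k) = ereal (V k)" and V: "V \<longlonglongrightarrow> M0"
    and cluster: "\<And>p r. strict_mono r \<Longrightarrow> (z \<circ> r) \<longlonglongrightarrow> p \<Longrightarrow> L p = ereal M0"
    and u: "\<And>k. u k \<in> regular_subdiff L (z k)" "\<And>k. norm (u k) \<le> Q * \<delta> k" and "Q > 0"
    and \<delta>: "\<And>k. 0 \<le> \<delta> k" "\<delta> \<longlonglongrightarrow> 0"
    and M: "M \<longlonglongrightarrow> M0" and "\<kappa> > 0" "C > 0"
    and decrease: "\<And>k. \<kappa> * (\<delta> k)\<^sup>2 \<le> M k - M (Suc k)"
    and gap: "\<And>k. M k - V k \<le> C * (M k - M (Suc k))"
  shows "summable \<delta>"
proof -
  let ?A = "{p. \<exists>r. strict_mono r \<and> (z \<circ> r) \<longlonglongrightarrow> p}"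
  have "u \<longlonglongrightarrow> 0"
  proof (rule Lim_null_comparison)
    show "(\<lambda>k. Q * \<delta> k) \<longlonglongrightarrow> 0" using tendsto_mult_left[OF \<delta>(2), of Q] by simp
  qed (simp add: u(2))
  \<comment> \<open>The Kurdyka-Lojasiewicz data at \<open>p\<close>, with the inequality stated
    only at the points \<open>z k\<close> and with \<open>Q * \<delta> k\<close> in place of the
    subgradient norm, packed for a single application of choice.\<close>
  define P where "P p a U \<phi> \<phi>' \<longleftrightarrow> a > 0 \<and> open U \<and> p \<in> U \<and> concave_on {0..<a} \<phi> \<and>
    (\<forall>s. 0 \<le> s \<and> s < a \<longrightarrow> 0 \<le> \<phi> s) \<and>
    (\<forall>s. 0 < s \<and> s < a \<longrightarrow> (\<phi> has_real_derivative \<phi>' s) (at s) \<and> 0 < \<phi>' s) \<and>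
    (\<forall>k. z k \<in> U \<and> M0 < V k \<and> V k < M0 + a \<longrightarrow> 1 \<le> \<phi>' (V k - M0) * (Q * \<delta> k))"
    for p a U \<phi> \<phi>'
  have ex: "\<exists>a U \<phi> \<phi>'. P p a U \<phi> \<phi>'" if "p \<in> ?A" for p
  proof -
    from that obtain r where r: "strict_mono r" "(z \<circ> r) \<longlonglongrightarrow> p" by blast
    have p: "L p = ereal M0" using cluster[OF r] .
    have "(V \<circ> r) \<longlonglongrightarrow> M0" "(u \<circ> r) \<longlonglongrightarrow> 0"
      using LIMSEQ_subseq_LIMSEQ[OF V r(1)] LIMSEQ_subseq_LIMSEQ[OF \<open>u \<longlonglongrightarrow> 0\<close> r(1)] by auto
    \<comment> \<open>The subgradients \<open>u k\<close> tend to 0 along the subsequence and the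
      values converge to \<open>L p\<close>, so \<open>p\<close> is a critical point and hence in
      the domain where the property is available.\<close>
    have "\<exists>xs us. (\<forall>j::nat. us j \<in> regular_subdiff L (xs j)) \<and>
        xs \<longlonglongrightarrow> p \<and> (\<lambda>j. L (xs j)) \<longlonglongrightarrow> L p \<and> us \<longlonglongrightarrow> 0"
    proof (rule exI[of _ "z \<circ> r"], rule exI[of _ "u \<circ> r"])
      show "(\<forall>j. (u \<circ> r) j \<in> regular_subdiff L ((z \<circ> r) j)) \<and> (z \<circ> r) \<longlonglongrightarrow> p \<and>
          (\<lambda>j. L ((z \<circ> r) j)) \<longlonglongrightarrow> L p \<and> (u \<circ> r) \<longlonglongrightarrow> 0"
        using \<open>(V \<circ> r) \<longlonglongrightarrow> M0\<close> \<open>(u \<circ> r) \<longlonglongrightarrow> 0\<close> r(2) u(1) by (simp add: p L o_def)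
    qed
    then have "0 \<in> limiting_subdiff L p" unfolding limiting_subdiff_def by (simp add: p)
    then have "KL_property_at L p" using KL by (auto simp: KL_function_def)
    from this p show ?thesis
    proof (rule KL_property_atE)
      fix a U \<phi> \<phi>'
      assume *: "a > 0" "open U" "p \<in> U" "concave_on {0..<a} \<phi>"
        "\<And>s. 0 \<le> s \<Longrightarrow> s < a \<Longrightarrow> 0 \<le> \<phi> s"
        "\<And>s. 0 < s \<Longrightarrow> s < a \<Longrightarrow> (\<phi> has_real_derivative \<phi>' s) (at s)"
        and pos: "\<And>s. 0 < s \<Longrightarrow> s < a \<Longrightarrow> 0 < \<phi>' s"
        and ineq: "\<And>z y u. z \<in> U \<Longrightarrow> L z = ereal y \<Longrightarrow> M0 < y \<Longrightarrow> y < M0 + a \<Longrightarrow>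
          u \<in> limiting_subdiff L z \<Longrightarrow> 1 \<le> \<phi>' (y - M0) * norm u"
      have "1 \<le> \<phi>' (V k - M0) * (Q * \<delta> k)" if "z k \<in> U" "M0 < V k" "V k < M0 + a" for k
      proof -
        have "1 \<le> \<phi>' (V k - M0) * norm (u k)"
          using ineq[OF that(1) L that(2,3)] u(1) regular_subset_limiting_subdiff by blast
        also have "\<dots> \<le> \<phi>' (V k - M0) * (Q * \<delta> k)"
          using pos[of "V k - M0"] that u(2) by (intro mult_left_mono) auto
        finally show ?thesis .
      qed
      then have "P p a U \<phi> \<phi>'" using * pos by (simp add: P_def)
      then show ?thesis by blast
    qed
  qed
  have "\<forall>p\<in>?A. \<exists>q. P p (fst q) (fst (snd q)) (fst (snd (snd q))) (snd (snd (snd q)))"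
    using ex by simp
  then obtain q where
    "\<forall>p\<in>?A. P p (fst (q p)) (fst (snd (q p))) (fst (snd (snd (q p)))) (snd (snd (snd (q p))))"
    by (rule bchoice[THEN exE])
  moreover define a U \<phi> \<phi>' where "a = fst \<circ> q" "U = fst \<circ> snd \<circ> q" "\<phi> = fst \<circ> snd \<circ> snd \<circ> q"
    "\<phi>' = snd \<circ> snd \<circ> snd \<circ> q"
  ultimately have P: "P p (a p) (U p) (\<phi> p) (\<phi>' p)" if "p \<in> ?A" for p
    using that by simp
  obtain J where J: "finite J" "\<And>p. p \<in> J \<Longrightarrow> \<exists>r. strict_mono r \<and> (z \<circ> r) \<longlonglongrightarrow> p"
    and ev: "\<forall>\<^sub>F k in sequentially. \<exists>p\<in>J. z k \<in> U p"
  proof (rule eventually_in_cluster_neighbourhoods[where U = U, OF \<open>compact S\<close> assms(3)])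
    show "open (U p) \<and> p \<in> U p" if "strict_mono r" "(z \<circ> r) \<longlonglongrightarrow> p" for p r
      using P[of p] that by (auto simp: P_def)
  qed blast
  have J': "P p (a p) (U p) (\<phi> p) (\<phi>' p)" if "p \<in> J" for p using P J(2)[OF that] by blast
  \<comment> \<open>A common interval length for all points of \<open>J\<close>; the inserted 1
    covers an empty \<open>J\<close>.\<close>
  define a0 where "a0 = Min (insert 1 (a ` J))"
  have a0: "a0 > 0" "\<And>p. p \<in> J \<Longrightarrow> a0 \<le> a p"
    using J(1) J' by (auto simp: a0_def P_def)
  have "\<forall>\<^sub>F k in sequentially. V k < M0 + a0"
    using order_tendstoD(2)[OF V, of "M0 + a0"] a0(1) by simp
  with ev have KL_ev: "\<forall>\<^sub>F k in sequentially. M0 < V k \<longrightarrow> (\<exists>p\<in>J. 1 \<le> \<phi>' p (V k - M0) * (Q * \<delta> k))"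
  proof eventually_elim
    case (elim k)
    then obtain p where p: "p \<in> J" "z k \<in> U p" by blast
    have "V k < M0 + a p" using elim(2) a0(2)[OF p(1)] by simp
    then show ?case using J'[OF p(1)] p unfolding P_def by blast
  qed
  show ?thesis
  proof (rule KL_summable[where J = J and a = a0 and \<phi> = \<phi> and \<phi>' = \<phi>' and M = M and L = V
        and R = Q and C = C and \<kappa> = \<kappa> and ?M0.0 = M0])
    show "concave_on {0..<a0} (\<phi> p)" if "p \<in> J" for p
    proof -
      have "concave_on {0..<a p} (\<phi> p)" using J'[OF that] by (simp add: P_def)
      then show ?thesis using a0(2)[OF that] unfolding concave_on_def
        by (elim convex_on_subset) auto
    qed
    show "0 \<le> \<phi> p s" if "p \<in> J" "0 \<le> s" "s < a0" for p s
      using J'[OF that(1)] a0(2)[OF that(1)] that unfolding P_def by (meson less_le_trans)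
    show "(\<phi> p has_real_derivative \<phi>' p s) (at s)" "0 < \<phi>' p s" if "p \<in> J" "0 < s" "s < a0" for p s
      using J'[OF that(1)] a0(2)[OF that(1)] that unfolding P_def by (meson less_le_trans)+
  qed (use assms a0(1) J(1) KL_ev in blast)+
qed

subsection \<open>Families of smooth functions\<close>

text \<open>The norm of a matrix is here its norm as a vector of rows, not the operator norm. A
  crude dimension factor does no harm, as only the existence of uniform bounds matters.\<close>

lemma norm_matrix_vector_mult_le:
  fixes A :: "real^'n^'m"
  shows "norm (A *v x) \<le> (real CARD('m) * real CARD('n) * norm A) * norm x"
proof -
  have "onorm ((*v) A) \<le> real CARD('m) * real CARD('n) * norm A"
  proof (rule onorm_le_matrix_component)
    show "\<bar>A $ i $ j\<bar> \<le> norm A" for i j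
      using component_le_norm_cart[of "A $ i" j] Finite_Cartesian_Product.norm_nth_le[of A i] by simp
  qed
  then show ?thesis
    using onorm[OF matrix_vector_mul_bounded_linear, of A x]
    by (meson mult_right_mono norm_ge_zero order_trans)
qed

lemma bounded_matrix_vector_mult:
  fixes A :: "'a \<Rightarrow> real^'n^'m"
  assumes "bounded (A ` S)"
  obtains R where "R > 0" "\<And>s u. s \<in> S \<Longrightarrow> norm (A s *v u) \<le> R * norm u"
proof -
  obtain b where b: "b > 0" "\<And>s. s \<in> S \<Longrightarrow> norm (A s) \<le> b"
    using assms by (auto simp: bounded_pos)
  show thesis
  proof
    show "real CARD('m) * real CARD('n) * b > 0" using b by simp
    fix s u assume "s \<in> S"
    then have "real CARD('m) * real CARD('n) * norm (A s) \<le> real CARD('m) * real CARD('n) * b"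
      using b by (intro mult_left_mono) auto
    then show "norm (A s *v u) \<le> real CARD('m) * real CARD('n) * b * norm u"
      using norm_matrix_vector_mult_le[of "A s" u] by (meson mult_right_mono norm_ge_zero order_trans)
  qed
qed

text \<open>Mean value inequality on the ball around \<open>z\<close> through \<open>z'\<close>,
  where the gradient varies by at most \<open>K * norm (z' - z)\<close>. The sharp factor 1/2 is
  given up.\<close>

lemma gderiv_lipschitz_remainder:
  fixes h :: "'a::real_inner \<Rightarrow> real"
  assumes der: "\<And>z. GDERIV h z :> h' z" and lip: "K-lipschitz_on UNIV h'"
  shows "\<bar>h z' - h z - h' z \<bullet> (z' - z)\<bar> \<le> K * (norm (z' - z))\<^sup>2"
proof -
  have K: "0 \<le> K" using lip lipschitz_on_nonneg by blast
  let ?S = "cball z (norm (z' - z))"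
  have "norm (h z' - h z - h' z \<bullet> (z' - z)) \<le> norm (z' - z) * (K * norm (z' - z))"
  proof (rule differentiable_bound_linearization[where S = ?S and f' = "\<lambda>y u. h' y \<bullet> u"])
    show "z + t *\<^sub>R (z' - z) \<in> ?S" if "t \<in> {0..1}" for t
      using that by (auto simp: dist_norm mult_left_le_one_le)
    show "(h has_derivative (\<bullet>) (h' y)) (at y within ?S)" for y
      using der[of y] unfolding gderiv_def inner_commute[of _ "h' y"]
      by (rule has_derivative_at_withinI)
    show "onorm ((\<lambda>u. h' y \<bullet> u) - (\<lambda>u. h' z \<bullet> u)) \<le> K * norm (z' - z)" if "y \<in> ?S" for y
    proof (rule onorm_bound)
      fix u
      have "dist (h' y) (h' z) \<le> K * dist y z"
        using lip by (auto simp: lipschitz_on_def)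
      also have "\<dots> \<le> K * norm (z' - z)"
        using that K by (auto simp: dist_commute intro!: mult_left_mono)
      finally have *: "norm (h' y - h' z) \<le> K * norm (z' - z)" by (simp add: dist_norm)
      have "norm (((\<lambda>u. h' y \<bullet> u) - (\<lambda>u. h' z \<bullet> u)) u) = \<bar>(h' y - h' z) \<bullet> u\<bar>"
        by (simp add: inner_diff_left)
      also have "\<dots> \<le> norm (h' y - h' z) * norm u" by (rule Cauchy_Schwarz_ineq2)
      also have "\<dots> \<le> K * norm (z' - z) * norm u"
        using * by (rule mult_right_mono) simp
      finally show "norm (((\<lambda>u. h' y \<bullet> u) - (\<lambda>u. h' z \<bullet> u)) u) \<le> K * norm (z' - z) * norm u" .
    qed (use K in simp)
  qed auto
  then show ?thesis by (simp add: power2_eq_square mult_ac)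
qed

lemma bounded_family_on_compact:
  fixes F :: "'i \<Rightarrow> 'a::topological_space \<Rightarrow> 'b::metric_space"
  assumes "finite J" "compact D" "\<And>i. i \<in> J \<Longrightarrow> continuous_on D (F i)"
  shows "bounded ((\<lambda>(i, z). F i z) ` (J \<times> D))"
proof -
  have "(\<lambda>(i, z). F i z) ` (J \<times> D) = (\<Union>i\<in>J. F i ` D)" by auto
  moreover have "compact (\<Union>i\<in>J. F i ` D)"
    using assms by (intro compact_UN compact_continuous_image) auto
  ultimately show ?thesis by (simp add: compact_imp_bounded)
qed

text \<open>Hessians enter through the derivative of a linearized constraint with respect to its
  base point. Finiteness of \<open>J\<close> and compactness of \<open>D\<close> yield one bound for
  all of them.\<close>

lemma C2_family_hessians:
  fixes c :: "'i \<Rightarrow> real^'n \<Rightarrow> real"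
  assumes "finite J" "compact D" "\<And>i. i \<in> J \<Longrightarrow> C2_function (c i)"
  obtains A R where "R > 0"
    "\<And>i z. i \<in> J \<Longrightarrow> (grad (c i) has_derivative (\<lambda>u. A i z *v u)) (at z)"
    "\<And>i z u. i \<in> J \<Longrightarrow> z \<in> D \<Longrightarrow> norm (A i z *v u) \<le> R * norm u"
proof -
  have "\<forall>i\<in>J. \<exists>A. (\<forall>z. (grad (c i) has_derivative (\<lambda>u. A z *v u)) (at z)) \<and> continuous_on UNIV A"
    using assms(3) by (auto simp: C2_function_def)
  then obtain A where A: "\<And>i z. i \<in> J \<Longrightarrow> (grad (c i) has_derivative (\<lambda>u. A i z *v u)) (at z)"
    "\<And>i. i \<in> J \<Longrightarrow> continuous_on UNIV (A i)"
    by (metis (no_types, lifting) bchoice)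
  have "bounded ((\<lambda>(i, z). A i z) ` (J \<times> D))"
    using assms A(2) by (intro bounded_family_on_compact) (auto intro: continuous_on_subset)
  then show thesis
  proof (rule bounded_matrix_vector_mult)
    fix R :: real
    assume "R > 0" and R: "\<And>p u. p \<in> J \<times> D \<Longrightarrow> norm ((\<lambda>(i, z). A i z) p *v u) \<le> R * norm u"
    show thesis
      using R by (intro that[OF \<open>R > 0\<close> A(1)]) force+
  qed
qed

text \<open>Iterates may be infeasible, so the expansion is wanted at arbitrary points. The sum of
  the individual constants serves the whole family.\<close>

lemma C1_family_remainder:
  fixes c :: "'i \<Rightarrow> 'a::real_inner \<Rightarrow> real"
  assumes "finite J" "\<And>i z. i \<in> J \<Longrightarrow> GDERIV (c i) z :> grad (c i) z"
    and "\<And>i. i \<in> J \<Longrightarrow> \<exists>K. K-lipschitz_on UNIV (grad (c i))"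
  obtains K where "K \<ge> 0"
    "\<And>i z z'. i \<in> J \<Longrightarrow> \<bar>c i z' - c i z - grad (c i) z \<bullet> (z' - z)\<bar> \<le> K * (norm (z' - z))\<^sup>2"
proof -
  obtain K where K: "\<And>i. i \<in> J \<Longrightarrow> (K i)-lipschitz_on UNIV (grad (c i))"
    using assms(3) by metis
  have nonneg: "0 \<le> K i" if "i \<in> J" for i using K[OF that] by (rule lipschitz_on_nonneg)
  show thesis
  proof
    show "0 \<le> sum K J" using nonneg by (rule sum_nonneg)
    fix i z z' assume i: "i \<in> J"
    have "\<bar>c i z' - c i z - grad (c i) z \<bullet> (z' - z)\<bar> \<le> K i * (norm (z' - z))\<^sup>2"
      using gderiv_lipschitz_remainder[OF assms(2)[OF i] K[OF i]] .
    also have "\<dots> \<le> sum K J * (norm (z' - z))\<^sup>2"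
      using member_le_sum[of i J K] i nonneg \<open>finite J\<close> by (intro mult_right_mono) auto
    finally show "\<bar>c i z' - c i z - grad (c i) z \<bullet> (z' - z)\<bar> \<le> sum K J * (norm (z' - z))\<^sup>2" .
  qed
qed

subsection \<open>The merit function along exact steps\<close>

lemma abs_le_max_norm: "finite J \<Longrightarrow> i \<in> J \<Longrightarrow> \<bar>a i\<bar> \<le> max_norm J a"
  unfolding max_norm_def by (rule Max_ge) auto

text \<open>The solution of a subproblem has vanishing slacks and satisfies these relations as soon as its
  multipliers are smaller than the penalty parameter.\<close>

definition exact_step ::
  "'i set \<Rightarrow> 'i set \<Rightarrow> ('i \<Rightarrow> real^'n \<Rightarrow> real) \<Rightarrow> real \<Rightarrow> real^'n \<Rightarrow> real^'n \<Rightarrow> real^'n^'n \<Rightarrow>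
   real^'n \<Rightarrow> ('i \<Rightarrow> real) \<Rightarrow> bool" where
  "exact_step E I c \<theta> x g B d lam \<longleftrightarrow>
     g + B *v d = (\<Sum>i\<in>E \<union> I. lam i *\<^sub>R grad (c i) x) \<and>
     (\<forall>i\<in>E. c i x + grad (c i) x \<bullet> d = 0) \<and>
     (\<forall>i\<in>I. 0 \<le> c i x + grad (c i) x \<bullet> d \<and> 0 \<le> lam i \<and>
            lam i * (c i x + grad (c i) x \<bullet> d) = 0) \<and>
     (\<forall>i\<in>E \<union> I. \<bar>lam i\<bar> \<le> \<theta>)"

text \<open>Since \<open>\<gamma> > 0\<close>, every multiplier is strictly smaller than
  \<open>\<theta>\<close> in absolute value. Thus \<open>p\<close>, \<open>q\<close>,
  \<open>r\<close> are positive, and complementarity forces the slacks to vanish.\<close>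

lemma exact_stepI:
  assumes "finite E" "finite I" "\<gamma> > 0"
    and sub: "solves_subproblem E I c fk \<theta> x g B (d, v, w, t)"
    and mult: "subproblem_multiplier E I c \<theta> x g B (d, v, w, t) lam"
    and \<theta>: "max_norm (E \<union> I) lam + \<gamma> \<le> \<theta>"
  shows "exact_step E I c \<theta> x g B d lam"
proof -
  have lam: "\<bar>lam i\<bar> < \<theta>" if "i \<in> E \<union> I" for i
    using abs_le_max_norm[of "E \<union> I" i lam] that assms by simp
  have region: "\<And>i. i \<in> E \<Longrightarrow> c i x + grad (c i) x \<bullet> d = v i - w i"
    "\<And>i. i \<in> I \<Longrightarrow> c i x + grad (c i) x \<bullet> d \<ge> - t i"
    using sub by (auto simp: solves_subproblem_def is_arg_min_def subproblem_region_def lin_constr_def)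
  have "v i = 0 \<and> w i = 0" if "i \<in> E" for i
    using mult lam[of i] that unfolding subproblem_multiplier_def by auto
  moreover have "t i = 0" if "i \<in> I" for i
    using mult lam[of i] that unfolding subproblem_multiplier_def by auto
  ultimately show ?thesis
    using region mult lam unfolding exact_step_def subproblem_multiplier_def
    by (auto simp: less_imp_le)
qed

lemma exact_step_lin_feasible:
  "exact_step E I c \<theta> x g B d lam \<Longrightarrow> (x + d, x) \<in> lin_feasible_pairs E I c"
  by (auto simp: exact_step_def lin_feasible_pairs_def lin_constr_def)

lemma exact_step_complementarity:
  assumes "exact_step E I c \<theta> x g B d lam" "i \<in> E \<union> I"
  shows "lam i * (c i x + grad (c i) x \<bullet> d) = 0"
  using assms by (auto simp: exact_step_def)

text \<open>Take the inner product of the stationarity condition with \<open>d\<close>;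
  complementarity turns each \<open>lam i * (grad (c i) x \<bullet> d)\<close> into
  \<open>- (lam i * c i x)\<close>.\<close>

lemma exact_step_inner:
  assumes "exact_step E I c \<theta> x g B d lam"
  shows "g \<bullet> d = - (d \<bullet> (B *v d)) - (\<Sum>i\<in>E \<union> I. lam i * c i x)"
proof -
  have "(g + B *v d) \<bullet> d = (\<Sum>i\<in>E \<union> I. lam i * (grad (c i) x \<bullet> d))"
    using assms by (simp add: exact_step_def inner_sum_left)
  also have "\<dots> = (\<Sum>i\<in>E \<union> I. - (lam i * c i x))"
  proof (rule sum.cong[OF refl])
    fix i assume "i \<in> E \<union> I"
    then have "lam i * c i x + lam i * (grad (c i) x \<bullet> d) = 0"
      using exact_step_complementarity[OF assms] by (simp flip: distrib_left)
    then show "lam i * (grad (c i) x \<bullet> d) = - (lam i * c i x)" by linarith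
  qed
  finally show ?thesis by (simp add: inner_add_left inner_commute[of d] sum_negf)
qed

text \<open>Along an exact step \<open>d\<close> the first-order decrease of the merit function is
  \<open>d \<bullet> (B *v d) + gain\<close>.\<close>

definition gain ::
  "'i set \<Rightarrow> 'i set \<Rightarrow> ('i \<Rightarrow> real^'n \<Rightarrow> real) \<Rightarrow> real \<Rightarrow> real^'n \<Rightarrow> ('i \<Rightarrow> real) \<Rightarrow> real" where
  "gain E I c \<theta> x lam = (\<Sum>i\<in>E \<union> I. lam i * c i x) + \<theta> * violation E I c x"

text \<open>Nonnegative term by term: \<open>\<bar>lam i\<bar> \<le> \<theta>\<close> settles
  equalities and violated inequalities, \<open>0 \<le> lam i\<close> the satisfied
  inequalities.\<close>

lemma exact_step_gain_nonneg:
  assumes "finite E" "finite I" "E \<inter> I = {}" "exact_step E I c \<theta> x g B d lam"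
  shows "0 \<le> gain E I c \<theta> x lam"
proof -
  have "0 \<le> lam i * c i x + \<theta> * \<bar>c i x\<bar>" if "i \<in> E" for i
  proof -
    have "\<bar>lam i * c i x\<bar> \<le> \<theta> * \<bar>c i x\<bar>"
      using assms(4) that by (auto simp: exact_step_def abs_mult intro!: mult_right_mono)
    then show ?thesis by linarith
  qed
  moreover have "0 \<le> lam i * c i x + \<theta> * neg_part (c i x)" if "i \<in> I" for i
  proof -
    have "0 \<le> lam i" "\<bar>lam i\<bar> \<le> \<theta>"
      using assms(4) that unfolding exact_step_def by blast+
    then have lam: "0 \<le> lam i" "lam i \<le> \<theta>" by auto
    show ?thesis
    proof (cases "0 \<le> c i x")
      case False
      then have "\<theta> * c i x \<le> lam i * c i x" using lam by (intro mult_right_mono_neg) auto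
      then show ?thesis using False by (simp add: neg_part_def)
    qed (use lam in \<open>simp add: neg_part_def\<close>)
  qed
  ultimately have "0 \<le> (\<Sum>i\<in>E. lam i * c i x + \<theta> * \<bar>c i x\<bar>)
      + (\<Sum>i\<in>I. lam i * c i x + \<theta> * neg_part (c i x))"
    by (intro add_nonneg_nonneg[OF sum_nonneg sum_nonneg])
  also have "\<dots> = gain E I c \<theta> x lam"
    using assms(1-3)
    by (simp add: gain_def violation_def sum.union_disjoint sum.distrib sum_distrib_left distrib_left)
  finally show ?thesis .
qed

text \<open>The linearization at \<open>x + a *\<^sub>R d\<close> is a convex combination of
  \<open>c i x\<close> and the value after the full step. The latter is zero or of the right sign,
  so the violation shrinks by the factor \<open>1 - a\<close>, up to the remainder \<open>r\<close>
  of each constraint.\<close>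

lemma violation_along_exact_step:
  assumes "finite E" "finite I" "E \<inter> I = {}" and step: "exact_step E I c \<theta> x g B d lam"
    and a: "0 \<le> a" "a \<le> 1"
    and rem: "\<And>i. i \<in> E \<union> I \<Longrightarrow> \<bar>c i (x + a *\<^sub>R d) - c i x - a * (grad (c i) x \<bullet> d)\<bar> \<le> r"
  shows "violation E I c (x + a *\<^sub>R d) \<le> (1 - a) * violation E I c x + real (card (E \<union> I)) * r"
proof -
  have lin: "c i x + a * (grad (c i) x \<bullet> d) = (1 - a) * c i x + a * (c i x + grad (c i) x \<bullet> d)" for i
    by (simp add: algebra_simps)
  have "\<bar>c i (x + a *\<^sub>R d)\<bar> \<le> (1 - a) * \<bar>c i x\<bar> + r" if "i \<in> E" for i
  proof -
    have "c i x + a * (grad (c i) x \<bullet> d) = (1 - a) * c i x"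
      using lin[of i] step that by (simp add: exact_step_def)
    moreover have "\<bar>(1 - a) * c i x\<bar> = (1 - a) * \<bar>c i x\<bar>" using a by (simp add: abs_mult)
    moreover have "\<bar>c i (x + a *\<^sub>R d) - (c i x + a * (grad (c i) x \<bullet> d))\<bar> \<le> r"
      using rem[of i] that by (simp add: diff_diff_eq)
    ultimately show ?thesis
      using abs_triangle_ineq2[of "c i (x + a *\<^sub>R d)" "(1 - a) * c i x"] by simp
  qed
  moreover have "neg_part (c i (x + a *\<^sub>R d)) \<le> (1 - a) * neg_part (c i x) + r" if "i \<in> I" for i
  proof -
    have "0 \<le> a * (c i x + grad (c i) x \<bullet> d)" using step that a by (simp add: exact_step_def)
    moreover have "- ((1 - a) * neg_part (c i x)) \<le> (1 - a) * c i x" "0 \<le> (1 - a) * neg_part (c i x)"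
    proof -
      have "(1 - a) * (- neg_part (c i x)) \<le> (1 - a) * c i x"
        using a by (intro mult_left_mono) (auto simp: neg_part_def)
      then show "- ((1 - a) * neg_part (c i x)) \<le> (1 - a) * c i x" by simp
      show "0 \<le> (1 - a) * neg_part (c i x)" using a by (simp add: neg_part_def)
    qed
    ultimately show ?thesis
      using rem[of i] that lin[of i] unfolding neg_part_def[of "c i (x + a *\<^sub>R d)"] by auto
  qed
  ultimately have "violation E I c (x + a *\<^sub>R d)
      \<le> (\<Sum>i\<in>E. (1 - a) * \<bar>c i x\<bar> + r) + (\<Sum>i\<in>I. (1 - a) * neg_part (c i x) + r)"
    unfolding violation_def by (intro add_mono sum_mono)
  also have "\<dots> = (1 - a) * violation E I c x + real (card (E \<union> I)) * r"
    using assms(1-3)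
    by (simp add: violation_def sum.distrib sum_distrib_left card_Un_disjoint distrib_left distrib_right)
  finally show ?thesis .
qed

text \<open>By \<open>exact_step_inner\<close>, the slope \<open>g \<bullet> d\<close> of the
  objective and the slope \<open>- \<theta> * violation E I c x\<close> of the penalty term add up
  to \<open>- (d \<bullet> (B *v d) + gain)\<close>.\<close>

lemma merit_along_exact_step:
  assumes "finite E" "finite I" "E \<inter> I = {}" and step: "exact_step E I c \<theta> x g B d lam"
    and "0 \<le> \<theta>" and a: "0 \<le> a" "a \<le> 1"
    and rem: "\<And>i. i \<in> E \<union> I \<Longrightarrow> \<bar>c i (x + a *\<^sub>R d) - c i x - a * (grad (c i) x \<bullet> d)\<bar> \<le> r"
    and h: "h (x + a *\<^sub>R d) \<le> h x + a * (g \<bullet> d) + s"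
  shows "h (x + a *\<^sub>R d) + \<theta> * violation E I c (x + a *\<^sub>R d)
    \<le> h x + \<theta> * violation E I c x - a * (d \<bullet> (B *v d) + gain E I c \<theta> x lam)
      + (s + \<theta> * (real (card (E \<union> I)) * r))"
proof -
  have "\<theta> * violation E I c (x + a *\<^sub>R d)
      \<le> \<theta> * ((1 - a) * violation E I c x + real (card (E \<union> I)) * r)"
    using violation_along_exact_step[OF assms(1-4) a rem] \<open>0 \<le> \<theta>\<close> by (intro mult_left_mono)
  then show ?thesis using h exact_step_inner[OF step] by (simp add: gain_def algebra_simps)
qed

text \<open>The line search reduced to scalars: \<open>m a\<close> is the merit value at step size
  \<open>a\<close>, \<open>q\<close> the curvature term, \<open>e\<close> the gain and
  \<open>n\<close> the squared norm of the direction. The constant \<open>\<kappa>\<close> is fixed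
  before these, so it is the same for all iterations. The acceptance test controls only
  \<open>q\<close>; the quadratic model has to supply the part of the decrease in
  \<open>e\<close>.\<close>

lemma armijo_decrease:
  fixes \<beta> C \<eta> \<tau> :: real
  assumes "\<beta> > 0" "C > 0" "0 < \<eta>" "\<eta> < 1" "0 < \<tau>" "\<tau> < 1"
  obtains \<kappa> where "\<kappa> > 0"
    "\<And>m q e n j. 0 \<le> n \<Longrightarrow> 0 \<le> e \<Longrightarrow> \<beta> * n \<le> q \<Longrightarrow>
       (\<And>a. 0 \<le> a \<Longrightarrow> a \<le> 1 \<Longrightarrow> m a \<le> m 0 - a * (q + e) + C * a\<^sup>2 * n) \<Longrightarrow>
       \<eta> * \<tau> ^ j * (1/2) * q \<le> m 0 - m (\<tau> ^ j) \<Longrightarrow>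
       (\<And>j'. j' < j \<Longrightarrow> \<not> \<eta> * \<tau> ^ j' * (1/2) * q \<le> m 0 - m (\<tau> ^ j')) \<Longrightarrow>
       \<kappa> * (n + e) \<le> m 0 - m (\<tau> ^ j)"
proof -
  \<comment> \<open>Lower bound for the accepted step size: a rejected size \<open>a\<close>
    satisfies \<open>\<beta> < 2 * C * a\<close> by the model, and the accepted one is either 1 or
    \<open>\<tau>\<close> times a rejected one.\<close>
  define \<alpha> where "\<alpha> = min 1 (\<tau> * (\<beta> / (2 * C)))"
  define p where "p = \<eta> * \<alpha> * \<beta> / 2"
  \<comment> \<open>Weight for combining the bound \<open>p * n\<close> from acceptance with the
    bound \<open>\<alpha> * e - C * n\<close> from the model, chosen so that the coefficient of
    \<open>n\<close> is still \<open>p / 2\<close>.\<close>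
  define s where "s = p / 2 / (C + p)"
  define \<kappa> where "\<kappa> = min (p / 2) (s * \<alpha>)"
  have "\<alpha> > 0" using assms by (simp add: \<alpha>_def)
  then have "p > 0" using assms by (simp add: p_def)
  then have s: "s > 0" "s < 1" using assms by (auto simp: s_def divide_simps)
  have sp: "(1 - s) * p - s * C = p / 2"
  proof -
    have "C + p \<noteq> 0" using \<open>p > 0\<close> assms by linarith
    then have "s * (C + p) = p / 2" by (simp add: s_def field_simps)
    then show ?thesis by (simp add: algebra_simps)
  qed
  show thesis
  proof
    show "\<kappa> > 0" using \<open>\<alpha> > 0\<close> \<open>p > 0\<close> s by (simp add: \<kappa>_def)
    fix m :: "real \<Rightarrow> real" and q e n :: real and j :: nat
    assume n: "0 \<le> n" and e: "0 \<le> e" and q: "\<beta> * n \<le> q"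
      and model: "\<And>a. 0 \<le> a \<Longrightarrow> a \<le> 1 \<Longrightarrow> m a \<le> m 0 - a * (q + e) + C * a\<^sup>2 * n"
      and acc: "\<eta> * \<tau> ^ j * (1/2) * q \<le> m 0 - m (\<tau> ^ j)"
      and rej: "\<And>j'. j' < j \<Longrightarrow> \<not> \<eta> * \<tau> ^ j' * (1/2) * q \<le> m 0 - m (\<tau> ^ j')"
    have "0 \<le> \<beta> * n" using n assms by simp
    then have "0 \<le> q" using q by linarith
    have \<tau>: "0 < \<tau> ^ i" "\<tau> ^ i \<le> 1" for i using assms by (auto simp: power_le_one)
    have "\<alpha> \<le> \<tau> ^ j"
    proof (cases j)
      case (Suc i)
      define a where "a = \<tau> ^ i"
      have a: "0 < a" "a \<le> 1" using \<tau> by (auto simp: a_def)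
      have "a * q + a * e - C * a\<^sup>2 * n < \<eta> * a * (1/2) * q"
        using rej[of i] model[of a] a Suc by (simp add: a_def algebra_simps)
      moreover have "0 \<le> a * e" using a e by simp
      moreover have "\<eta> * (a * q) \<le> 1 * (a * q)"
        using a \<open>0 \<le> q\<close> assms by (intro mult_right_mono) auto
      ultimately have "a * q < a * (2 * C * a * n)" by (simp add: power2_eq_square algebra_simps)
      then have "q < 2 * C * a * n" using a by simp
      then have lt: "\<beta> * n < 2 * C * a * n" using q by linarith
      then have "n \<noteq> 0" by auto
      then have "\<beta> < 2 * C * a" using lt n by simp
      then have "\<tau> * (\<beta> / (2 * C)) \<le> \<tau> * a" using assms by (intro mult_left_mono) (auto simp: field_simps)
      then show ?thesis using Suc by (simp add: \<alpha>_def a_def)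
    qed (simp add: \<alpha>_def)
    have "\<alpha> * (\<beta> * n) \<le> \<tau> ^ j * q"
      using \<open>\<alpha> \<le> \<tau> ^ j\<close> q \<tau>[of j] \<open>0 \<le> \<beta> * n\<close> by (intro mult_mono) auto
    then have "\<eta> * (\<alpha> * (\<beta> * n)) \<le> \<eta> * (\<tau> ^ j * q)" using assms by (intro mult_left_mono) auto
    then have 1: "p * n \<le> m 0 - m (\<tau> ^ j)" using acc by (simp add: p_def)
    have "C * (\<tau> ^ j)\<^sup>2 * n \<le> C * 1 * n"
      using \<tau>[of j] assms n by (intro mult_right_mono mult_left_mono) (auto simp: power_le_one)
    moreover have "\<alpha> * e \<le> \<tau> ^ j * e" using \<open>\<alpha> \<le> \<tau> ^ j\<close> e by (rule mult_right_mono)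
    moreover have "0 \<le> \<tau> ^ j * q" using \<tau>[of j] \<open>0 \<le> q\<close> by simp
    ultimately have 2: "\<alpha> * e - C * n \<le> m 0 - m (\<tau> ^ j)"
      using model[of "\<tau> ^ j"] \<tau>[of j] by (simp add: algebra_simps)
    have "\<kappa> * (n + e) \<le> p / 2 * n + s * \<alpha> * e"
      unfolding distrib_left using n e by (intro add_mono mult_right_mono) (auto simp: \<kappa>_def)
    also have "\<dots> = (1 - s) * (p * n) + s * (\<alpha> * e - C * n)"
      unfolding sp[symmetric] by (simp add: algebra_simps)
    also have "\<dots> \<le> (1 - s) * (m 0 - m (\<tau> ^ j)) + s * (m 0 - m (\<tau> ^ j))"
      using 1 2 s by (intro add_mono mult_left_mono) auto
    finally show "\<kappa> * (n + e) \<le> m 0 - m (\<tau> ^ j)" by (simp add: algebra_simps)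
  qed
qed

lemma violation_nonneg: "0 \<le> violation E I c x"
  unfolding violation_def by (intro add_nonneg_nonneg sum_nonneg) (auto simp: neg_part_def)

text \<open>The step \<open>d\<close> restores linearized feasibility, so no residual can exceed
  \<open>\<bar>grad (c i) x \<bullet> d\<bar>\<close>.\<close>

lemma exact_step_violation_le:
  assumes "finite E" "finite I" "E \<inter> I = {}" and step: "exact_step E I c \<theta> x g B d lam"
    and G: "\<And>i. i \<in> E \<union> I \<Longrightarrow> norm (grad (c i) x) \<le> G"
  shows "violation E I c x \<le> real (card (E \<union> I)) * (G * norm d)"
proof -
  have gd: "\<bar>grad (c i) x \<bullet> d\<bar> \<le> G * norm d" if "i \<in> E \<union> I" for i
    using Cauchy_Schwarz_ineq2[of "grad (c i) x" d] mult_right_mono[OF G[OF that] norm_ge_zero, of d]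
    by linarith
  have "\<bar>c i x\<bar> \<le> G * norm d" if "i \<in> E" for i
  proof -
    have "c i x = - (grad (c i) x \<bullet> d)" using step that by (auto simp: exact_step_def)
    then show ?thesis using gd[of i] that by simp
  qed
  moreover have "neg_part (c i x) \<le> G * norm d" if "i \<in> I" for i
  proof -
    have "0 \<le> c i x + grad (c i) x \<bullet> d" using step that by (auto simp: exact_step_def)
    then show ?thesis using gd[of i] that by (auto simp: neg_part_def)
  qed
  ultimately have "violation E I c x \<le> (\<Sum>i\<in>E. G * norm d) + (\<Sum>i\<in>I. G * norm d)"
    unfolding violation_def by (intro add_mono sum_mono)
  then show ?thesis using assms(1-3) by (simp add: card_Un_disjoint algebra_simps)
qed

subsection \<open>Subgradients of the potential\<close>

text \<open>After completing the square, \<open>sub\<close> says that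
  \<open>\<sigma> *\<^sub>R x - g\<close> is a subgradient of \<open>neg_shift f D \<sigma>\<close>
  at \<open>x\<close>. Hence \<open>conjugate_eq\<close> evaluates the conjugate, and the quadratic
  terms combine.\<close>

lemma potential_eq:
  fixes h :: "real^'n \<Rightarrow> real"
  assumes "x \<in> D" and fin: "\<And>z. z \<in> D \<Longrightarrow> f z = ereal (h z)"
    and sub: "\<And>z. z \<in> D \<Longrightarrow> h z - h x - g \<bullet> (z - x) \<le> \<sigma> / 2 * (norm (z - x))\<^sup>2"
    and feas: "(p, x) \<in> lin_feasible_pairs E I c"
  shows "potential f E I c D \<sigma> l (p, \<sigma> *\<^sub>R x - g, x)
    = ereal (h x + g \<bullet> (p - x) + (\<sigma> + l) / 2 * (norm (p - x))\<^sup>2)"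
proof -
  let ?y = "\<sigma> *\<^sub>R x - g" and ?F = "\<lambda>x. - h x + \<sigma> / 2 * (norm x)\<^sup>2"
  have "conjugate (neg_shift f D \<sigma>) ?y = ereal (?y \<bullet> x - ?F x)"
  proof (rule conjugate_eq)
    show "ereal (?F x + ?y \<bullet> (z - x)) \<le> neg_shift f D \<sigma> z" for z
    proof (cases "z \<in> D")
      case True
      have "?F x + ?y \<bullet> (z - x) \<le> ?F z"
        using sub[OF True]
        by (simp add: power2_norm_eq_inner inner_diff_left inner_diff_right inner_commute algebra_simps)
      then show ?thesis using True by (simp add: neg_shift_def fin)
    qed (simp add: neg_shift_def)
    show "neg_shift f D \<sigma> x = ereal (?F x)" using \<open>x \<in> D\<close> by (simp add: neg_shift_def fin)
  qed
  then have "potential f E I c D \<sigma> l (p, ?y, x)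
    = ereal (- (?y \<bullet> p) + (?y \<bullet> x - ?F x) + \<sigma> / 2 * (norm p)\<^sup>2 + l / 2 * (norm (p - x))\<^sup>2)"
    using feas by (simp add: potential_def)
  also have "- (?y \<bullet> p) + (?y \<bullet> x - ?F x) + \<sigma> / 2 * (norm p)\<^sup>2 + l / 2 * (norm (p - x))\<^sup>2
    = h x + g \<bullet> (p - x) + (\<sigma> + l) / 2 * (norm (p - x))\<^sup>2"
    by (simp add: power2_norm_eq_inner inner_diff_left inner_diff_right inner_commute field_simps)
  finally show ?thesis .
qed

text \<open>In the base point \<open>w\<close> the two gradient contributions cancel and only the
  Hessian applied to \<open>x - w\<close> survives. At the points of interest \<open>x - w\<close>
  is the step, so this partial derivative is of the order of the step.\<close>

lemma lin_constr_has_derivative: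
  fixes h :: "real^'n \<Rightarrow> real"
  assumes 1: "GDERIV h w :> grad h w" and 2: "(grad h has_derivative (\<lambda>u. A *v u)) (at w)"
  shows "((\<lambda>p :: (real^'n) \<times> (real^'n) \<times> (real^'n). lin_constr h (fst p) (snd (snd p)))
    has_derivative (\<lambda>u. grad h w \<bullet> fst u + ((x - w) v* A) \<bullet> snd (snd u))) (at (x, y, w))"
proof -
  have snd: "((\<lambda>p. snd (snd p)) has_derivative (\<lambda>u. snd (snd u))) (at (x, y, w))"
    by (auto intro!: derivative_eq_intros)
  have "((\<lambda>p. h (snd (snd p))) has_derivative (\<lambda>u. snd (snd u) \<bullet> grad h w)) (at (x, y, w))"
    using has_derivative_compose[OF snd, of h "\<lambda>u. u \<bullet> grad h w"] 1 by (simp add: gderiv_def)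
  moreover have "((\<lambda>p. grad h (snd (snd p))) has_derivative (\<lambda>u. A *v snd (snd u))) (at (x, y, w))"
    using has_derivative_compose[OF snd, of "grad h" "\<lambda>u. A *v u"] 2 by simp
  ultimately have "((\<lambda>p. h (snd (snd p)) + grad h (snd (snd p)) \<bullet> (fst p - snd (snd p))) has_derivative
      (\<lambda>u. snd (snd u) \<bullet> grad h w +
        (grad h w \<bullet> (fst u - snd (snd u)) + (A *v snd (snd u)) \<bullet> (x - w)))) (at (x, y, w))"
    by (auto intro!: derivative_eq_intros)
  then show ?thesis unfolding lin_constr_def
    by (rule has_derivative_eq_rhs)
      (auto simp: fun_eq_iff dot_lmul_matrix inner_diff_right inner_commute algebra_simps)
qed

text \<open>A bound for a matrix carries over to its transpose: test with the vector
  \<open>d v* A\<close> itself.\<close>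

lemma norm_vector_matrix_mult_le:
  fixes A :: "real^'n^'m"
  assumes "\<And>u. norm (A *v u) \<le> R * norm u" and "0 \<le> R"
  shows "norm (d v* A) \<le> R * norm d"
proof -
  let ?q = "d v* A"
  have "norm ?q * norm ?q = d \<bullet> (A *v ?q)"
    by (simp add: dot_lmul_matrix[symmetric] power2_norm_eq_inner[symmetric] power2_eq_square)
  also have "\<dots> \<le> norm d * norm (A *v ?q)" by (rule norm_cauchy_schwarz)
  also have "\<dots> \<le> norm d * (R * norm ?q)" using assms by (intro mult_left_mono) auto
  finally have "norm ?q * norm ?q \<le> norm ?q * (R * norm d)" by (simp add: mult_ac)
  then show ?thesis using \<open>0 \<le> R\<close> by (cases "?q = 0") (auto simp: mult_le_cancel_left)
qed

lemma norm_triple_le: "norm (a, b, c) \<le> norm a + norm b + norm c"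
  using norm_Pair_le[of a "(b, c)"] norm_Pair_le[of b c] by linarith

text \<open>The subgradient is the gradient of a smooth function touching the potential from below:
  \<open>F\<^sup>*\<close> is replaced by its affine minorant at \<open>\<sigma> x - g\<close> (Fenchel--Young), the indicator by
  \<open>- \<Sum>\<lambda>\<^sub>i c\<^sub>i\<close> (linearized), which is nonpositive on the linearized feasible pairs.\<close>

lemma potential_subgradient:
  fixes h :: "real^'n \<Rightarrow> real" and c :: "'i \<Rightarrow> real^'n \<Rightarrow> real"
  assumes "x \<in> D" and fin: "\<And>z. z \<in> D \<Longrightarrow> f z = ereal (h z)"
    and sub: "\<And>z. z \<in> D \<Longrightarrow> h z - h x - g \<bullet> (z - x) \<le> \<sigma> / 2 * (norm (z - x))\<^sup>2"
    and step: "exact_step E I c \<theta> x g B d lam"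
    and c1: "\<And>i. i \<in> E \<union> I \<Longrightarrow> GDERIV (c i) x :> grad (c i) x"
    and c2: "\<And>i. i \<in> E \<union> I \<Longrightarrow> (grad (c i) has_derivative (\<lambda>u. A i *v u)) (at x)"
    and A: "\<And>i u. i \<in> E \<union> I \<Longrightarrow> norm (A i *v u) \<le> R * norm u"
    and B: "\<And>u. norm (B *v u) \<le> R * norm u"
    and "0 \<le> \<sigma>" "0 \<le> l" "0 \<le> \<theta>" "0 \<le> R"
  shows "\<exists>u\<in>regular_subdiff (potential f E I c D \<sigma> l) (x + d, \<sigma> *\<^sub>R x - g, x).
    norm u \<le> (R + \<sigma> + 2 * l + 1 + real (card (E \<union> I)) * (\<theta> * R)) * norm d"
proof -
  define y where "y = \<sigma> *\<^sub>R x - g"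
  define S where "S p = - (fst (snd p) \<bullet> fst p) + (fst (snd p) \<bullet> x - (- h x + \<sigma> / 2 * (norm x)\<^sup>2))
    + \<sigma> / 2 * (fst p \<bullet> fst p) + l / 2 * ((fst p - snd (snd p)) \<bullet> (fst p - snd (snd p)))
    - (\<Sum>i\<in>E \<union> I. lam i * lin_constr (c i) (fst p) (snd (snd p)))"
    for p :: "(real^'n) \<times> (real^'n) \<times> (real^'n)"
  \<comment> \<open>In the first component stationarity, \<open>g + B *v d = (\<Sum>i\<in>E \<union>
    I. lam i *\<^sub>R grad (c i) x)\<close>, removes \<open>g\<close> and the constraint gradients,
    so that all three components are linear in \<open>d\<close>.\<close>
  define u where "u = ((\<sigma> + l) *\<^sub>R d - B *v d, - d, - (l *\<^sub>R d) - (\<Sum>i\<in>E \<union> I. lam i *\<^sub>R (d v* A i)))"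
  have lin: "((\<lambda>p. lin_constr (c i) (fst p) (snd (snd p)))
    has_derivative (\<lambda>u. grad (c i) x \<bullet> fst u + (d v* A i) \<bullet> snd (snd u))) (at (x + d, y, x))"
    if "i \<in> E \<union> I" for i
    using lin_constr_has_derivative[OF c1 c2, OF that that, of "x + d" y] by simp
  have "(S has_derivative (\<lambda>p.
      - (y \<bullet> fst p + fst (snd p) \<bullet> (x + d)) + fst (snd p) \<bullet> x + \<sigma> * ((x + d) \<bullet> fst p)
      + l * (d \<bullet> (fst p - snd (snd p)))
      - (\<Sum>i\<in>E \<union> I. lam i * (grad (c i) x \<bullet> fst p + (d v* A i) \<bullet> snd (snd p))))) (at (x + d, y, x))"
    unfolding S_def
    by (rule derivative_eq_intros lin refl | assumption)+
      (auto simp: fun_eq_iff inner_commute algebra_simps)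
  moreover have "- (y \<bullet> fst p + fst (snd p) \<bullet> (x + d)) + fst (snd p) \<bullet> x + \<sigma> * ((x + d) \<bullet> fst p)
      + l * (d \<bullet> (fst p - snd (snd p)))
      - (\<Sum>i\<in>E \<union> I. lam i * (grad (c i) x \<bullet> fst p + (d v* A i) \<bullet> snd (snd p))) = p \<bullet> u" for p
  proof -
    have "(\<Sum>i\<in>E \<union> I. lam i * (grad (c i) x \<bullet> fst p))
        = (\<Sum>i\<in>E \<union> I. lam i *\<^sub>R grad (c i) x) \<bullet> fst p"
      by (simp add: inner_sum_left)
    also have "(\<Sum>i\<in>E \<union> I. lam i *\<^sub>R grad (c i) x) = g + B *v d"
      using step by (simp add: exact_step_def)
    finally have "(\<Sum>i\<in>E \<union> I. lam i * (grad (c i) x \<bullet> fst p)) = (g + B *v d) \<bullet> fst p" .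
    moreover have "(\<Sum>i\<in>E \<union> I. lam i * ((d v* A i) \<bullet> snd (snd p)))
        = (\<Sum>i\<in>E \<union> I. lam i *\<^sub>R (d v* A i)) \<bullet> snd (snd p)"
      by (simp add: inner_sum_left)
    ultimately show ?thesis
      by (cases p) (simp add: u_def y_def distrib_left sum.distrib inner_add_left inner_add_right
          inner_diff_left inner_diff_right inner_commute algebra_simps)
  qed
  ultimately have der: "GDERIV S (x + d, y, x) :> u" by (simp add: gderiv_def)
  have minor: "ereal (S p) \<le> potential f E I c D \<sigma> l p" for p
  proof (cases p)
    case (fields p1 p2 p3)
    show ?thesis
    proof (cases "(p1, p3) \<in> lin_feasible_pairs E I c")
      case True
      have "0 \<le> (\<Sum>i\<in>E \<union> I. lam i * lin_constr (c i) p1 p3)"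
        using True step by (intro sum_nonneg) (auto simp: lin_feasible_pairs_def exact_step_def)
      then have "S p \<le> - (p2 \<bullet> p1) + (p2 \<bullet> x - (- h x + \<sigma> / 2 * (norm x)\<^sup>2))
          + \<sigma> / 2 * (norm p1)\<^sup>2 + l / 2 * (norm (p1 - p3))\<^sup>2"
        by (simp add: S_def fields power2_norm_eq_inner)
      moreover have "ereal (p2 \<bullet> x - (- h x + \<sigma> / 2 * (norm x)\<^sup>2)) \<le> conjugate (neg_shift f D \<sigma>) p2"
        unfolding conjugate_def using \<open>x \<in> D\<close>
        by (intro SUP_upper2[of x]) (auto simp: neg_shift_def fin)
      ultimately show ?thesis using True
        by (cases "conjugate (neg_shift f D \<sigma>) p2") (auto simp: potential_def fields)
    qed (simp add: potential_def fields)
  qed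
  have "S (x + d, y, x) = h x + g \<bullet> d + (\<sigma> + l) / 2 * (norm d)\<^sup>2"
  proof -
    have "(\<Sum>i\<in>E \<union> I. lam i * lin_constr (c i) (x + d) x) = 0"
      using exact_step_complementarity[OF step] by (intro sum.neutral) (simp add: lin_constr_def)
    then show ?thesis
      by (simp add: S_def y_def power2_norm_eq_inner inner_add_left inner_add_right inner_diff_left
          inner_diff_right inner_commute field_simps)
  qed
  then have "potential f E I c D \<sigma> l (x + d, y, x) = ereal (S (x + d, y, x))"
    using potential_eq[OF \<open>x \<in> D\<close> fin sub exact_step_lin_feasible[OF step], of l] by (simp add: y_def)
  with minor der have "u \<in> regular_subdiff (potential f E I c D \<sigma> l) (x + d, y, x)"
    by (intro regular_subdiffI)
  moreover have "norm u \<le> (R + \<sigma> + 2 * l + 1 + real (card (E \<union> I)) * (\<theta> * R)) * norm d"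
  proof -
    have "norm (\<Sum>i\<in>E \<union> I. lam i *\<^sub>R (d v* A i)) \<le> (\<Sum>i\<in>E \<union> I. \<theta> * (R * norm d))"
    proof (rule sum_norm_le)
      fix i assume i: "i \<in> E \<union> I"
      then have "\<bar>lam i\<bar> \<le> \<theta>" using step unfolding exact_step_def by blast
      then show "norm (lam i *\<^sub>R (d v* A i)) \<le> \<theta> * (R * norm d)"
        using norm_vector_matrix_mult_le[OF A[OF i] \<open>0 \<le> R\<close>, of d] \<open>0 \<le> \<theta>\<close> by (auto intro!: mult_mono)
    qed
    then have 3: "norm (- (l *\<^sub>R d) - (\<Sum>i\<in>E \<union> I. lam i *\<^sub>R (d v* A i)))
        \<le> l * norm d + real (card (E \<union> I)) * (\<theta> * (R * norm d))"
      using norm_triangle_ineq4[of "- (l *\<^sub>R d)" "\<Sum>i\<in>E \<union> I. lam i *\<^sub>R (d v* A i)"] \<open>0 \<le> l\<close> by simp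
    have 1: "norm ((\<sigma> + l) *\<^sub>R d - B *v d) \<le> (\<sigma> + l) * norm d + R * norm d"
      using norm_triangle_ineq4[of "(\<sigma> + l) *\<^sub>R d" "B *v d"] B[of d] \<open>0 \<le> \<sigma>\<close> \<open>0 \<le> l\<close> by simp
    have "norm u \<le> ((\<sigma> + l) * norm d + R * norm d) + norm d
        + (l * norm d + real (card (E \<union> I)) * (\<theta> * (R * norm d)))"
      unfolding u_def by (rule order_trans[OF norm_triple_le]) (use 1 3 in simp)
    then show ?thesis by (simp add: algebra_simps)
  qed
  ultimately show ?thesis unfolding y_def by blast
qed

subsection \<open>Limits of exact steps\<close>

text \<open>Induction over the constraints, refining the subsequence once for each of them.\<close>

lemma bounded_family_convergent_subsequence:
  fixes a :: "nat \<Rightarrow> 'i \<Rightarrow> real"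
  assumes "finite J" "\<And>k i. i \<in> J \<Longrightarrow> \<bar>a k i\<bar> \<le> M"
  shows "\<exists>r l. strict_mono r \<and> (\<forall>i\<in>J. (\<lambda>k. a (r k) i) \<longlonglongrightarrow> l i)"
  using assms
proof (induction J)
  case empty
  show ?case by (intro exI[of _ id]) (auto simp: strict_mono_def)
next
  case (insert j J)
  then obtain r l where r: "strict_mono r" "\<forall>i\<in>J. (\<lambda>k. a (r k) i) \<longlonglongrightarrow> l i" by blast
  have "bounded (range (\<lambda>k. a (r k) j))"
    using insert.prems by (auto simp: bounded_iff)
  then obtain l' s where s: "strict_mono s" "((\<lambda>k. a (r k) j) \<circ> s) \<longlonglongrightarrow> l'"
    using bounded_imp_convergent_subsequence by blast
  have "(\<lambda>k. a ((r \<circ> s) k) i) \<longlonglongrightarrow> (l(j := l')) i" if "i \<in> insert j J" for i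
    using r(2) s LIMSEQ_subseq_LIMSEQ[of "\<lambda>k. a (r k) i" "l i" s] that insert.hyps
    by (auto simp: o_def)
  then show ?case using strict_mono_o[OF r(1) s(1)] by blast
qed

text \<open>The linearized constraints hold at every step and differ from the constraints by a term
  that vanishes with \<open>d k\<close>.\<close>

lemma exact_steps_limit_feasible:
  assumes x: "x \<longlonglongrightarrow> z" and d: "d \<longlonglongrightarrow> 0"
    and step: "\<And>k::nat. exact_step E I c \<theta> (x k) (g k) (B k) (d k) (lam k)"
    and c: "\<And>i. i \<in> E \<union> I \<Longrightarrow> isCont (c i) z" "\<And>i. i \<in> E \<union> I \<Longrightarrow> isCont (grad (c i)) z"
  shows "z \<in> feasible_set E I c"
    and "i \<in> E \<union> I \<Longrightarrow> (\<lambda>k. c i (x k) + grad (c i) (x k) \<bullet> d k) \<longlonglongrightarrow> c i z"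
proof -
  show lim: "(\<lambda>k. c i (x k) + grad (c i) (x k) \<bullet> d k) \<longlonglongrightarrow> c i z" if "i \<in> E \<union> I" for i
  proof -
    have "(\<lambda>k. c i (x k) + grad (c i) (x k) \<bullet> d k) \<longlonglongrightarrow> c i z + grad (c i) z \<bullet> 0"
      using that by (intro tendsto_intros d isCont_tendsto_compose[OF c(1) x] isCont_tendsto_compose[OF c(2) x])
    then show ?thesis by simp
  qed
  have "c i z = 0" if "i \<in> E" for i
    using lim[of i] step that LIMSEQ_unique[OF _ tendsto_const] by (auto simp: exact_step_def)
  moreover have "0 \<le> c i z" if "i \<in> I" for i
    using lim[of i] step that by (intro LIMSEQ_le_const[of _ "c i z" 0]) (auto simp: exact_step_def)
  ultimately show "z \<in> feasible_set E I c" by (auto simp: feasible_set_def)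
qed

text \<open>The multipliers are bounded by \<open>\<theta>\<close> and the subgradients by
  assumption, so both converge along a common subsequence. The terms \<open>B k *v d k\<close>
  vanish, and closedness of the Clarke subdifferential identifies the limit of the
  subgradients.\<close>

lemma exact_steps_limit_kkt:
  fixes f :: "real^'n \<Rightarrow> ereal"
  assumes "finite E" "finite I" and x: "x \<longlonglongrightarrow> z" and d: "d \<longlonglongrightarrow> 0"
    and step: "\<And>k::nat. exact_step E I c \<theta> (x k) (g k) (B k) (d k) (lam k)"
    and c: "\<And>i. i \<in> E \<union> I \<Longrightarrow> isCont (c i) z" "\<And>i. i \<in> E \<union> I \<Longrightarrow> isCont (grad (c i)) z"
    and g: "bounded (range g)" "\<And>k. g k \<in> clarke_subdiff f (x k)"
    and B: "\<And>k u. norm (B k *v u) \<le> R * norm u"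
  shows "kkt_point f E I c z"
proof -
  have "\<bar>lam k i\<bar> \<le> \<theta>" if "i \<in> E \<union> I" for k i
    using step[of k] that unfolding exact_step_def by blast
  then obtain r l where r: "strict_mono r" and l: "\<forall>i\<in>E \<union> I. (\<lambda>k. lam (r k) i) \<longlonglongrightarrow> l i"
    using bounded_family_convergent_subsequence[of "E \<union> I" lam \<theta>] assms(1,2) by auto
  have "bounded (range (g \<circ> r))" using g(1) by (rule bounded_subset) auto
  then obtain g0 s where s: "strict_mono s" and g0: "((g \<circ> r) \<circ> s) \<longlonglongrightarrow> g0"
    using bounded_imp_convergent_subsequence by blast
  define q where "q = r \<circ> s"
  have q: "strict_mono q" using strict_mono_o[OF r s] by (simp add: q_def)
  have lam: "(\<lambda>k. lam (q k) i) \<longlonglongrightarrow> l i" if "i \<in> E \<union> I" for i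
    using LIMSEQ_subseq_LIMSEQ[OF l[rule_format, OF that] s] by (simp add: q_def o_def)
  have gq: "(\<lambda>k. g (q k)) \<longlonglongrightarrow> g0" using g0 by (simp add: q_def o_def)
  have xq: "(\<lambda>k. x (q k)) \<longlonglongrightarrow> z" and dq: "(\<lambda>k. d (q k)) \<longlonglongrightarrow> 0"
    using LIMSEQ_subseq_LIMSEQ[OF x q] LIMSEQ_subseq_LIMSEQ[OF d q] by (auto simp: o_def)
  have Bd: "(\<lambda>k. B (q k) *v d (q k)) \<longlonglongrightarrow> 0"
  proof (rule Lim_null_comparison)
    show "(\<lambda>k. R * norm (d (q k))) \<longlonglongrightarrow> 0"
      using tendsto_mult_left[OF tendsto_norm[OF dq], of R] by simp
  qed (simp add: B)
  have step: "exact_step E I c \<theta> (x (q k)) (g (q k)) (B (q k)) (d (q k)) (lam (q k))" for k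
    by (rule step)
  have "(\<lambda>k. g (q k) + B (q k) *v d (q k)) \<longlonglongrightarrow> g0 + 0"
    using gq Bd by (rule tendsto_add)
  moreover have "(\<lambda>k. g (q k) + B (q k) *v d (q k)) \<longlonglongrightarrow> (\<Sum>i\<in>E \<union> I. l i *\<^sub>R grad (c i) z)"
  proof -
    have "(\<lambda>k. \<Sum>i\<in>E \<union> I. lam (q k) i *\<^sub>R grad (c i) (x (q k))) \<longlonglongrightarrow> (\<Sum>i\<in>E \<union> I. l i *\<^sub>R grad (c i) z)"
      by (intro tendsto_sum tendsto_scaleR lam isCont_tendsto_compose[OF c(2) xq])
    then show ?thesis using step by (simp add: exact_step_def)
  qed
  ultimately have "g0 + 0 = (\<Sum>i\<in>E \<union> I. l i *\<^sub>R grad (c i) z)" by (rule LIMSEQ_unique)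
  moreover have "g0 \<in> clarke_subdiff f z"
    using clarke_subdiff_closed[OF xq gq] g(2) by blast
  moreover have "0 \<le> l i \<and> l i * c i z = 0" if "i \<in> I" for i
  proof
    have i: "i \<in> E \<union> I" using that by simp
    show "0 \<le> l i"
      using step that by (intro LIMSEQ_le_const[OF lam[OF i]]) (auto simp: exact_step_def)
    have "(\<lambda>k. lam (q k) i * (c i (x (q k)) + grad (c i) (x (q k)) \<bullet> d (q k))) \<longlonglongrightarrow> l i * c i z"
      by (intro tendsto_mult lam[OF i] exact_steps_limit_feasible(2)[OF xq dq step c i])
    then have "(\<lambda>k::nat. 0) \<longlonglongrightarrow> l i * c i z"
      unfolding exact_step_complementarity[OF step i] .
    from LIMSEQ_unique[OF this tendsto_const] show "l i * c i z = 0" .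
  qed
  ultimately show ?thesis
    using exact_steps_limit_feasible(1)[OF xq dq step c] unfolding kkt_point_def by auto
qed

subsection \<open>Convergence\<close>

text \<open>Indices start where the penalty parameter has become constant, so all steps are exact
  and all merit values use the same \<open>\<theta>\<close>. The inequality \<open>sub\<close>
  serves twice: as quadratic model of \<open>h\<close> along a step and as subgradient relation for
  the potential.\<close>

lemma exact_steps_summable:
  fixes f :: "real^'n \<Rightarrow> ereal" and h :: "real^'n \<Rightarrow> real" and c :: "'i \<Rightarrow> real^'n \<Rightarrow> real"
  assumes EI: "finite E" "finite I" "E \<inter> I = {}"
    and D: "convex D" "compact D" and fin: "\<And>z. z \<in> D \<Longrightarrow> f z = ereal (h z)"
    and h: "continuous_on D h"
    and sub: "\<And>k z. z \<in> D \<Longrightarrow> h z - h (x k) - g k \<bullet> (z - x k) \<le> \<sigma> / 2 * (norm (z - x k))\<^sup>2"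
    and G: "\<And>k. norm (g k) \<le> G"
    and c1: "\<And>i z. i \<in> E \<union> I \<Longrightarrow> GDERIV (c i) z :> grad (c i) z"
    and c_lip: "\<And>i. i \<in> E \<union> I \<Longrightarrow> \<exists>K. K-lipschitz_on UNIV (grad (c i))"
    and c2: "\<And>i. i \<in> E \<union> I \<Longrightarrow> C2_function (c i)"
    and x: "\<And>k. x k \<in> D" "\<And>k. x k + d k \<in> D"
    and "0 \<le> R" and B: "\<And>k u. norm (B k *v u) \<le> R * norm u"
    and \<beta>: "\<beta> > 0" "\<And>k u. u \<bullet> (B k *v u) \<ge> \<beta> * (norm u)\<^sup>2"
    and params: "0 < \<eta>" "\<eta> < 1" "0 < \<tau>" "\<tau> < 1"
    and step: "\<And>k. exact_step E I c \<theta> (x k) (g k) (B k) (d k) (lam k)"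
    and line_search: "\<And>k. \<exists>j. x (Suc k) = x k + \<tau> ^ j *\<^sub>R d k \<and>
      sufficient_decrease f E I c \<eta> \<theta> (x k) (B k) (d k) (\<tau> ^ j) \<and>
      (\<forall>j'<j. \<not> sufficient_decrease f E I c \<eta> \<theta> (x k) (B k) (d k) (\<tau> ^ j'))"
    and pos: "0 \<le> \<theta>" "0 < \<sigma>" "0 < l"
    and KL: "KL_function (potential f E I c D \<sigma> l)"
  shows "summable (\<lambda>k. norm (d k))"
proof -

  \<comment> \<open>Bounds uniform over the constraints and over \<open>D\<close>\<close>
  have fin': "finite (E \<union> I)" using EI by simp
  define N where "N = real (card (E \<union> I))"
  obtain K where K: "K \<ge> 0"
    "\<And>i z z'. i \<in> E \<union> I \<Longrightarrow> \<bar>c i z' - c i z - grad (c i) z \<bullet> (z' - z)\<bar> \<le> K * (norm (z' - z))\<^sup>2"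
    using C1_family_remainder[where J = "E \<union> I" and c = c] fin' c1 c_lip by metis
  obtain A R' where "R' > 0"
    and A: "\<And>i z. i \<in> E \<union> I \<Longrightarrow> (grad (c i) has_derivative (\<lambda>u. A i z *v u)) (at z)"
    and R': "\<And>i z u. i \<in> E \<union> I \<Longrightarrow> z \<in> D \<Longrightarrow> norm (A i z *v u) \<le> R' * norm u"
    by (rule C2_family_hessians[where c = c, OF fin' D(2)]) (use c2 in blast)+
  have cont_c: "isCont (c i) z" and cont_grad: "isCont (grad (c i)) z" if "i \<in> E \<union> I" for i z
    using c1[OF that, of z] A[OF that, of z]
    by (auto simp: gderiv_def intro: has_derivative_continuous)
  have "bounded ((\<lambda>(i, z). grad (c i) z) ` ((E \<union> I) \<times> D))"
    using fin' D(2) cont_grad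
    by (intro bounded_family_on_compact continuous_at_imp_continuous_on) auto
  then obtain Gc where Gc: "\<And>i z. i \<in> E \<union> I \<Longrightarrow> z \<in> D \<Longrightarrow> norm (grad (c i) z) \<le> Gc"
    unfolding bounded_iff by force

  \<comment> \<open>Decrease and limit of the merit values\<close>
  define m where "m k a = h (x k + a *\<^sub>R d k) + \<theta> * violation E I c (x k + a *\<^sub>R d k)" for k a
  define M where "M k = h (x k) + \<theta> * violation E I c (x k)" for k
  define e where "e k = gain E I c \<theta> (x k) (lam k)" for k
  define q where "q k = d k \<bullet> (B k *v d k)" for k
  have m0: "m k 0 = M k" for k by (simp add: m_def M_def)
  have inD: "x k + a *\<^sub>R d k \<in> D" if "0 \<le> a" "a \<le> 1" for k a
  proof -
    have "(1 - a) *\<^sub>R x k + a *\<^sub>R (x k + d k) \<in> D"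
      using x that by (intro convexD[OF D(1)]) auto
    then show ?thesis by (simp add: algebra_simps)
  qed
  have e_nonneg: "0 \<le> e k" for k
    unfolding e_def by (rule exact_step_gain_nonneg[OF EI step])
  \<comment> \<open>Curvature of the model: \<open>\<sigma> / 2\<close> from \<open>h\<close>, and
    \<open>K\<close> for each of the \<open>N\<close> constraints, weighted by the penalty.\<close>
  define C where "C = \<sigma> / 2 + \<theta> * (N * K)"
  have "C > 0" using pos K(1) by (simp add: C_def N_def add_pos_nonneg)
  have model: "m k a \<le> m k 0 - a * (q k + e k) + C * a\<^sup>2 * (norm (d k))\<^sup>2"
    if "0 \<le> a" "a \<le> 1" for k a
  proof -
    have "m k a \<le> h (x k) + \<theta> * violation E I c (x k) - a * (q k + e k)
        + (\<sigma> / 2 * (norm (a *\<^sub>R d k))\<^sup>2 + \<theta> * (N * (K * (norm (a *\<^sub>R d k))\<^sup>2)))"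
      unfolding m_def q_def e_def N_def
    proof (rule merit_along_exact_step[OF EI step pos(1) that])
      show "\<bar>c i (x k + a *\<^sub>R d k) - c i (x k) - a * (grad (c i) (x k) \<bullet> d k)\<bar> \<le> K * (norm (a *\<^sub>R d k))\<^sup>2"
        if "i \<in> E \<union> I" for i
        using K(2)[OF that, of "x k + a *\<^sub>R d k" "x k"] by simp
      show "h (x k + a *\<^sub>R d k) \<le> h (x k) + a * (g k \<bullet> d k) + \<sigma> / 2 * (norm (a *\<^sub>R d k))\<^sup>2"
        using sub[OF inD[OF that], of k k] by simp
    qed
    then show ?thesis
      by (simp add: m_def C_def power_mult_distrib algebra_simps)
  qed
  have suff: "sufficient_decrease f E I c \<eta> \<theta> (x k) (B k) (d k) a
      \<longleftrightarrow> \<eta> * a * (1/2) * q k \<le> m k 0 - m k a" if "0 \<le> a" "a \<le> 1" for k a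
    using fin[OF inD[OF that, of k]] fin[OF x(1)[of k]]
    by (simp add: sufficient_decrease_def merit_def m_def q_def)
  have q_lower: "\<beta> * (norm (d k))\<^sup>2 \<le> q k" for k using \<beta>(2) by (simp add: q_def)
  have q_upper: "q k \<le> R * (norm (d k))\<^sup>2" for k
  proof -
    have "q k \<le> norm (d k) * norm (B k *v d k)" unfolding q_def by (rule norm_cauchy_schwarz)
    also have "\<dots> \<le> norm (d k) * (R * norm (d k))" using B by (intro mult_left_mono) auto
    finally show ?thesis by (simp add: power2_eq_square mult_ac)
  qed
  \<comment> \<open>The term \<open>e k\<close> is kept beside the squared norm because the gap
    estimate between merit function and potential has to absorb it.\<close>
  obtain \<kappa> where "\<kappa> > 0" and \<kappa>: "\<kappa> * ((norm (d k))\<^sup>2 + e k) \<le> M k - M (Suc k)" for k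
  proof (rule armijo_decrease[OF \<beta>(1) \<open>C > 0\<close> params])
    fix \<kappa> :: real
    assume "\<kappa> > 0" and *: "\<And>m q e n j. 0 \<le> n \<Longrightarrow> 0 \<le> e \<Longrightarrow> \<beta> * n \<le> q \<Longrightarrow>
       (\<And>a. 0 \<le> a \<Longrightarrow> a \<le> 1 \<Longrightarrow> m a \<le> m 0 - a * (q + e) + C * a\<^sup>2 * n) \<Longrightarrow>
       \<eta> * \<tau> ^ j * (1/2) * q \<le> m 0 - m (\<tau> ^ j) \<Longrightarrow>
       (\<And>j'. j' < j \<Longrightarrow> \<not> \<eta> * \<tau> ^ j' * (1/2) * q \<le> m 0 - m (\<tau> ^ j')) \<Longrightarrow>
       \<kappa> * (n + e) \<le> m 0 - m (\<tau> ^ j)"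
    have "\<kappa> * ((norm (d k))\<^sup>2 + e k) \<le> M k - M (Suc k)" for k
    proof -
      have \<tau>: "0 \<le> \<tau> ^ i" "\<tau> ^ i \<le> 1" for i using params by (auto simp: power_le_one)
      obtain j where j: "x (Suc k) = x k + \<tau> ^ j *\<^sub>R d k"
        "sufficient_decrease f E I c \<eta> \<theta> (x k) (B k) (d k) (\<tau> ^ j)"
        "\<And>j'. j' < j \<Longrightarrow> \<not> sufficient_decrease f E I c \<eta> \<theta> (x k) (B k) (d k) (\<tau> ^ j')"
        using line_search by blast
      have "\<kappa> * ((norm (d k))\<^sup>2 + e k) \<le> m k 0 - m k (\<tau> ^ j)"
        by (rule *[OF _ e_nonneg q_lower model])
          (use j(2,3) suff[OF \<tau>, of k] in auto)
      then show ?thesis using j(1) by (simp add: m_def M_def)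
    qed
    with \<open>\<kappa> > 0\<close> show thesis by (rule that)
  qed
  have decrease: "\<kappa> * (norm (d k))\<^sup>2 \<le> M k - M (Suc k)" for k
    using \<kappa>[of k] e_nonneg[of k] \<open>\<kappa> > 0\<close> by (simp add: distrib_left add_increasing2 order_trans[rotated])
  obtain M0 where M: "M \<longlonglongrightarrow> M0"
  proof -
    have "decseq M" unfolding decseq_Suc_iff
    proof
      fix k
      have "0 \<le> \<kappa> * (norm (d k))\<^sup>2" using \<open>\<kappa> > 0\<close> by simp
      then show "M (Suc k) \<le> M k" using decrease[of k] by linarith
    qed
    obtain b where "\<And>y. y \<in> h ` D \<Longrightarrow> norm y \<le> b"
      using compact_imp_bounded[OF compact_continuous_image[OF h D(2)]] unfolding bounded_iff by blast
    then have "- b \<le> M k" for k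
    proof -
      have "norm (h (x k)) \<le> b" using \<open>\<And>y. y \<in> h ` D \<Longrightarrow> norm y \<le> b\<close> x(1) by blast
      moreover have "0 \<le> \<theta> * violation E I c (x k)" by (intro mult_nonneg_nonneg pos(1) violation_nonneg)
      ultimately show ?thesis by (simp add: M_def)
    qed
    then show thesis using decseq_convergent[OF \<open>decseq M\<close>, of "- b"] that by blast
  qed
  have d: "d \<longlonglongrightarrow> 0"
  proof -
    have "(\<lambda>k. (M k - M (Suc k)) / \<kappa>) \<longlonglongrightarrow> (M0 - M0) / \<kappa>"
      using \<open>\<kappa> > 0\<close> by (intro tendsto_intros M LIMSEQ_Suc) auto
    moreover have "(norm (d k))\<^sup>2 \<le> (M k - M (Suc k)) / \<kappa>" for k
      using decrease[of k] \<open>\<kappa> > 0\<close> by (simp add: field_simps)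
    ultimately have "(\<lambda>k. (norm (d k))\<^sup>2) \<longlonglongrightarrow> 0"
      by (intro Lim_null_comparison[of "\<lambda>k. (norm (d k))\<^sup>2" "\<lambda>k. (M k - M (Suc k)) / \<kappa>"]) auto
    then have "(\<lambda>k. sqrt ((norm (d k))\<^sup>2)) \<longlonglongrightarrow> sqrt 0" by (rule tendsto_real_sqrt)
    then show ?thesis by (simp add: tendsto_norm_zero_iff)
  qed
  have viol: "(\<lambda>k. violation E I c (x k)) \<longlonglongrightarrow> 0"
  proof (rule Lim_null_comparison)
    show "(\<lambda>k. N * (Gc * norm (d k))) \<longlonglongrightarrow> 0"
      using tendsto_mult_left[OF tendsto_mult_left[OF tendsto_norm_zero[OF d], of Gc], of N] by simp
    have "violation E I c (x k) \<le> N * (Gc * norm (d k))" for k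
      unfolding N_def by (rule exact_step_violation_le[OF EI step Gc[OF _ x(1)]])
    then show "\<forall>\<^sub>F k in sequentially. norm (violation E I c (x k)) \<le> N * (Gc * norm (d k))"
      by (simp add: violation_nonneg)
  qed
  have hx: "(\<lambda>k. h (x k)) \<longlonglongrightarrow> M0"
    using tendsto_diff[OF M tendsto_mult_left[OF viol, of \<theta>]] by (simp add: M_def)

  \<comment> \<open>Values, subgradients and cluster points of the potential\<close>
  define z where "z k = (x k + d k, \<sigma> *\<^sub>R x k - g k, x k)" for k
  define V where "V k = h (x k) + g k \<bullet> d k + (\<sigma> + l) / 2 * (norm (d k))\<^sup>2" for k
  \<comment> \<open>The constant of \<open>potential_subgradient\<close>, with
    \<open>max R R'\<close> as common bound for the matrices \<open>B k\<close> and the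
    Hessians.\<close>
  define Q where "Q = max R R' + \<sigma> + 2 * l + 1 + N * (\<theta> * max R R')"
  have "Q > 0" using \<open>R' > 0\<close> pos by (simp add: Q_def N_def add_pos_nonneg less_max_iff_disj)
  have potential_z: "potential f E I c D \<sigma> l (z k) = ereal (V k)" for k
    using potential_eq[OF x(1) fin sub exact_step_lin_feasible[OF step], of l] by (simp add: z_def V_def)
  have V: "V \<longlonglongrightarrow> M0"
  proof -
    have "(\<lambda>k. g k \<bullet> d k) \<longlonglongrightarrow> 0"
    proof (rule Lim_null_comparison)
      show "(\<lambda>k. G * norm (d k)) \<longlonglongrightarrow> 0"
        using tendsto_mult_left[OF tendsto_norm_zero[OF d], of G] by simp
      have "norm (g k \<bullet> d k) \<le> G * norm (d k)" for k
        using Cauchy_Schwarz_ineq2[of "g k" "d k"] mult_right_mono[OF G norm_ge_zero, of k "d k"] by simp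
      then show "\<forall>\<^sub>F k in sequentially. norm (g k \<bullet> d k) \<le> G * norm (d k)" by simp
    qed
    then have "V \<longlonglongrightarrow> M0 + 0 + (\<sigma> + l) / 2 * (norm (0 :: real^'n))\<^sup>2"
      unfolding V_def by (intro tendsto_intros hx d)
    then show ?thesis by simp
  qed
  \<comment> \<open>By \<open>exact_step_inner\<close> the difference is \<open>q k + e k\<close>
    minus a nonnegative quadratic term, and \<open>\<kappa>\<close> bounds both quantities by the
    decrease of \<open>M\<close>.\<close>
  have gap: "M k - V k \<le> max 1 R / \<kappa> * (M k - M (Suc k))" for k
  proof -
    have "0 \<le> (\<sigma> + l) / 2 * (norm (d k))\<^sup>2" using pos by simp
    then have "M k - V k \<le> q k + e k"
      using exact_step_inner[OF step, of k] by (simp add: M_def V_def q_def e_def gain_def)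
    also have "\<dots> \<le> max 1 R * (norm (d k))\<^sup>2 + max 1 R * e k"
    proof (rule add_mono)
      show "q k \<le> max 1 R * (norm (d k))\<^sup>2"
        using q_upper[of k] mult_right_mono[of R "max 1 R" "(norm (d k))\<^sup>2"] by simp
      show "e k \<le> max 1 R * e k"
        using mult_right_mono[of 1 "max 1 R" "e k"] e_nonneg[of k] by simp
    qed
    also have "\<dots> = max 1 R / \<kappa> * (\<kappa> * ((norm (d k))\<^sup>2 + e k))"
      using \<open>\<kappa> > 0\<close> by (simp add: distrib_left)
    also have "\<dots> \<le> max 1 R / \<kappa> * (M k - M (Suc k))"
      using \<kappa> \<open>\<kappa> > 0\<close> by (intro mult_left_mono) auto
    finally show ?thesis .
  qed
  have "\<exists>u\<in>regular_subdiff (potential f E I c D \<sigma> l) (z k). norm u \<le> Q * norm (d k)" for k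
    unfolding z_def Q_def N_def
  proof (rule potential_subgradient[OF x(1) fin sub step c1 A])
    show "norm (A i (x k) *v u) \<le> max R R' * norm u" if "i \<in> E \<union> I" for i u
      using R'[OF that x(1), of k u] mult_right_mono[of R' "max R R'" "norm u"] by simp
    show "norm (B k *v u) \<le> max R R' * norm u" for u
      using B[of k u] mult_right_mono[of R "max R R'" "norm u"] by simp
  qed (use pos \<open>0 \<le> R\<close> in auto)
  then obtain u where u: "\<And>k. u k \<in> regular_subdiff (potential f E I c D \<sigma> l) (z k)"
    "\<And>k. norm (u k) \<le> Q * norm (d k)"
    by metis
  obtain b where b: "\<And>z. z \<in> D \<Longrightarrow> norm z \<le> b"
    using compact_imp_bounded[OF D(2)] unfolding bounded_iff by blast
  have compact: "compact (D \<times> cball (0 :: real^'n) (\<sigma> * b + G) \<times> D)"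
    by (intro compact_Times D(2) compact_cball)
  have zD: "z k \<in> D \<times> cball 0 (\<sigma> * b + G) \<times> D" for k
  proof -
    have "norm (\<sigma> *\<^sub>R x k - g k) \<le> \<sigma> * norm (x k) + norm (g k)"
      using norm_triangle_ineq4[of "\<sigma> *\<^sub>R x k" "g k"] pos by simp
    also have "\<dots> \<le> \<sigma> * b + G" using b[OF x(1)] G pos by (intro add_mono mult_left_mono) auto
    finally show ?thesis using x by (simp add: z_def)
  qed
  have cluster: "potential f E I c D \<sigma> l p = ereal M0"
    if r: "strict_mono r" and zr: "(z \<circ> r) \<longlonglongrightarrow> p" for p r
  proof -
    obtain p1 p2 p3 where p: "p = (p1, p2, p3)" by (cases p)
    have dr: "(\<lambda>k. d (r k)) \<longlonglongrightarrow> 0" and hr: "(\<lambda>k. h (x (r k))) \<longlonglongrightarrow> M0"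
      using LIMSEQ_subseq_LIMSEQ[OF d r] LIMSEQ_subseq_LIMSEQ[OF hx r] by (auto simp: o_def)
    have xr: "(\<lambda>k. x (r k)) \<longlonglongrightarrow> p3"
      using tendsto_snd[OF tendsto_snd[OF zr]] by (simp add: z_def p o_def)
    have "(\<lambda>k. x (r k) + d (r k)) \<longlonglongrightarrow> p1"
      using tendsto_fst[OF zr] by (simp add: z_def p o_def)
    then have p1: "p1 = p3" using LIMSEQ_unique tendsto_add[OF xr dr] by fastforce
    have "(\<lambda>k. \<sigma> *\<^sub>R x (r k) - g (r k)) \<longlonglongrightarrow> p2"
      using tendsto_fst[OF tendsto_snd[OF zr]] by (simp add: z_def p o_def)
    from tendsto_diff[OF tendsto_scaleR[OF tendsto_const[of \<sigma>] xr] this]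
    have gr: "(\<lambda>k. g (r k)) \<longlonglongrightarrow> \<sigma> *\<^sub>R p3 - p2" by simp
    have p3: "p3 \<in> D"
      using closed_sequentially[OF compact_imp_closed[OF D(2)] _ xr] x(1) by blast
    have "(\<lambda>k. h (x (r k))) \<longlonglongrightarrow> h p3"
      by (rule continuous_on_tendsto_compose[OF h xr p3]) (simp add: x)
    then have h3: "h p3 = M0" using hr by (rule LIMSEQ_unique)
    have sub3: "h y - h p3 - (\<sigma> *\<^sub>R p3 - p2) \<bullet> (y - p3) \<le> \<sigma> / 2 * (norm (y - p3))\<^sup>2" if "y \<in> D" for y
    proof (rule LIMSEQ_le)
      show "(\<lambda>k. h y - h (x (r k)) - g (r k) \<bullet> (y - x (r k))) \<longlonglongrightarrow> h y - h p3 - (\<sigma> *\<^sub>R p3 - p2) \<bullet> (y - p3)"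
        unfolding h3 by (intro tendsto_intros hr gr xr)
      show "(\<lambda>k. \<sigma> / 2 * (norm (y - x (r k)))\<^sup>2) \<longlonglongrightarrow> \<sigma> / 2 * (norm (y - p3))\<^sup>2"
        by (intro tendsto_intros xr)
    qed (use sub[OF that] in auto)
    have "p3 \<in> feasible_set E I c"
      using cont_c cont_grad
      by (intro exact_steps_limit_feasible(1)[OF xr dr, of E I c \<theta> "g \<circ> r" "B \<circ> r" "lam \<circ> r"])
        (auto simp: step)
    then have "(p3, p3) \<in> lin_feasible_pairs E I c"
      by (auto simp: feasible_set_def lin_feasible_pairs_def lin_constr_def)
    from potential_eq[OF p3 fin sub3 this, of l] show ?thesis
      by (simp add: p p1 h3)
  qed
  show ?thesis
  proof (rule KL_function_summable[OF KL compact zD potential_z V cluster u \<open>Q > 0\<close> _ _ M \<open>\<kappa> > 0\<close> _ decrease gap])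
    show "(\<lambda>k. norm (d k)) \<longlonglongrightarrow> 0" using d by (rule tendsto_norm_zero)
    show "0 < max 1 R / \<kappa>" using \<open>\<kappa> > 0\<close> by simp
  qed auto
qed

theorem theorem5p17:
  fixes f :: "real^'n \<Rightarrow> ereal" and E I :: "'i set" and c :: "'i \<Rightarrow> real^'n \<Rightarrow> real"
    and D X :: "(real^'n) set"
    and \<rho> H c\<^sub>h b\<^sub>0 b c\<^sub>b \<sigma> l \<eta> \<tau> \<gamma> \<theta>bar Lip :: real
    and x g d :: "nat \<Rightarrow> real^'n" and B :: "nat \<Rightarrow> real^'n^'n"
    and v w t lam :: "nat \<Rightarrow> 'i \<Rightarrow> real" and \<theta> \<alpha> :: "nat \<Rightarrow> real"
  assumes index_sets: "finite E" "finite I" "E \<inter> I = {}"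
    and f_range: "\<And>z. f z \<noteq> -\<infinity>"
    (* (A1), on an open set X containing D *)
    and D: "convex D" "compact D"
    and X: "open X" "D \<subseteq> X"
    and f_lipschitz: "\<And>z. z \<in> X \<Longrightarrow> f z \<noteq> \<infinity>" "Lip-lipschitz_on X (\<lambda>z. real_of_ereal (f z))"
    and f_upper_C2: "upper_C2_on TYPE('t) f X"
    and \<rho>: "\<rho> > 0" "convex_on D (\<lambda>z. - real_of_ereal (f z) + \<rho> / 2 * (norm z)\<^sup>2)"
      "\<And>z z' h. z \<in> D \<Longrightarrow> z' \<in> D \<Longrightarrow> h \<in> clarke_subdiff f z' \<Longrightarrow>
         real_of_ereal (f z) - real_of_ereal (f z') - h \<bullet> (z - z') \<le> \<rho> / 2 * (norm (z - z'))\<^sup>2"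
    (* (A2) *)
    and c_C1: "\<And>i z. i \<in> E \<union> I \<Longrightarrow> GDERIV (c i) z :> grad (c i) z"
    and c_grad_lipschitz: "\<And>i. i \<in> E \<union> I \<Longrightarrow> \<exists>K. K-lipschitz_on UNIV (grad (c i))"
    and H: "H \<ge> 0"
      "\<And>i z z'. i \<in> E \<union> I \<Longrightarrow> z \<in> feasible_set E I c \<Longrightarrow> z' \<in> feasible_set E I c \<Longrightarrow>
         \<bar>c i z' - c i z - grad (c i) z \<bullet> (z' - z)\<bar> \<le> H / 2 * (norm (z - z'))\<^sup>2"
    and c\<^sub>h: "c\<^sub>h = real (card E + card I) * H"
    (* (A3); for the subproblem regions see the remark at subproblem_region_fst *)
    and feasible_D: "bounded (feasible_set E I c)" "feasible_set E I c \<subseteq> D"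
    and iterates_D: "\<And>k. x k \<in> D" "\<And>k. x k + d k \<in> D"
    and B_bounded: "bounded (range B)"
    and B_posdef: "b\<^sub>0 > 0" "\<And>k u. u \<bullet> (B k *v u) \<ge> b\<^sub>0 * (norm u)\<^sup>2"
    (* the algorithm *)
    and params: "0 < \<eta>" "\<eta> < 1" "0 < \<tau>" "\<tau> < 1" "\<gamma> > 0"
    and run: "sqp_run f E I c \<eta> \<tau> \<gamma> x g B d v w t lam \<theta> \<alpha>"
    and mfcq: "\<And>z r. strict_mono r \<Longrightarrow> (x \<circ> r) \<longlonglongrightarrow> z \<Longrightarrow> mfcq E I c z"
    and \<theta>bar: "\<forall>\<^sub>F k in sequentially. \<theta> k = \<theta>bar"
    (* the potential function *)
    and \<sigma>: "\<sigma> > 0" "convex_fun (neg_shift f D \<sigma>)"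
    and l: "l > 0"
    and KL: "KL_function (potential f E I c D \<sigma> l)"
    and c_C2: "\<And>i. i \<in> E \<union> I \<Longrightarrow> C2_function (c i)"
    (* the constants, with b a lower bound for the eigenvalues of B k for large k *)
    and b: "b > 0" "\<forall>\<^sub>F k in sequentially. \<forall>u. u \<bullet> (B k *v u) \<ge> b * (norm u)\<^sup>2"
    and c\<^sub>b: "0 < c\<^sub>b" "c\<^sub>b < 1" "c\<^sub>b * b - \<theta>bar * c\<^sub>h \<ge> 0"
    and bounds: "2 * b \<ge> l + \<sigma>" "l / c\<^sub>b > b" "b \<ge> \<sigma>" "\<sigma> \<ge> \<rho>"
  shows "\<exists>xbar. x \<longlonglongrightarrow> xbar \<and> kkt_point f E I c xbar"
proof -
  define h where "h z = real_of_ereal (f z)" for z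
  have fin: "f z = ereal (h z)" if "z \<in> X" for z
    using f_lipschitz(1)[OF that] f_range[of z] by (cases "f z") (auto simp: h_def)
  have lip: "Lip-lipschitz_on X h" using f_lipschitz(2) by (simp add: h_def[abs_def])
  have h: "continuous_on D h"
    using lipschitz_on_continuous_on[OF lip] X(2) by (rule continuous_on_subset)
  have g: "g k \<in> clarke_subdiff f (x k)" for k using run by (simp add: sqp_run_def)
  have g_bound: "norm (g k) \<le> Lip" for k
    by (rule clarke_subdiff_norm_le[OF X(1) _ fin lip g]) (use iterates_D X(2) in auto)
  obtain R where R: "R > 0" "\<And>k u. norm (B k *v u) \<le> R * norm u"
    by (rule bounded_matrix_vector_mult[OF B_bounded]) auto
  \<comment> \<open>The constant \<open>\<rho>\<close> is relaxed to \<open>\<sigma>\<close>, so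
    that the inequality fits the quadratic term of the potential.\<close>
  have sub: "h z - h (x k) - g k \<bullet> (z - x k) \<le> \<sigma> / 2 * (norm (z - x k))\<^sup>2" if "z \<in> D" for z k
  proof -
    have "h z - h (x k) - g k \<bullet> (z - x k) \<le> \<rho> / 2 * (norm (z - x k))\<^sup>2"
      using \<rho>(3)[OF that iterates_D(1) g] by (simp add: h_def)
    also have "\<dots> \<le> \<sigma> / 2 * (norm (z - x k))\<^sup>2" using bounds(4) by (intro mult_right_mono) auto
    finally show ?thesis .
  qed
  obtain N where N: "\<And>k. k \<ge> N \<Longrightarrow> \<theta> k = \<theta>bar"
    using \<theta>bar unfolding eventually_sequentially by blast
  \<comment> \<open>From \<open>N\<close> on, the updated parameter also equals
    \<open>\<theta>bar\<close>, and the update is a maximum that includes this term.\<close>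
  have penalty: "max_norm (E \<union> I) (lam (Suc (k + N))) + \<gamma> \<le> \<theta>bar" for k
  proof -
    have "\<theta> (Suc (k + N)) = max (\<theta> (k + N)) (max_norm (E \<union> I) (lam (Suc (k + N))) + \<gamma>)"
      using run by (simp add: sqp_run_def)
    then show ?thesis using N[of "Suc (k + N)"] by simp
  qed
  have "0 \<le> max_norm (E \<union> I) (lam (Suc (0 + N)))"
    unfolding max_norm_def using index_sets by (intro Max_ge) auto
  then have "0 \<le> \<theta>bar" using penalty[of 0] params(5) by linarith
  \<comment> \<open>The multiplier computed in iteration \<open>k\<close> carries the index
    \<open>Suc k\<close>.\<close>
  have step: "exact_step E I c \<theta>bar (x (k + N)) (g (k + N)) (B (k + N)) (d (k + N)) (lam (Suc (k + N)))" for k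
  proof (rule exact_stepI[OF index_sets(1,2) params(5) _ _ penalty])
    show "solves_subproblem E I c (real_of_ereal (f (x (k + N)))) \<theta>bar (x (k + N)) (g (k + N))
        (B (k + N)) (d (k + N), v (k + N), w (k + N), t (k + N))"
      and "subproblem_multiplier E I c \<theta>bar (x (k + N)) (g (k + N))
        (B (k + N)) (d (k + N), v (k + N), w (k + N), t (k + N)) (lam (Suc (k + N)))"
      using run N[of "k + N"] unfolding sqp_run_def by (metis le_add2)+
  qed
  have move: "\<exists>j. x (Suc k) = x k + \<tau> ^ j *\<^sub>R d k \<and>
      sufficient_decrease f E I c \<eta> (\<theta> k) (x k) (B k) (d k) (\<tau> ^ j) \<and>
      (\<forall>j'<j. \<not> sufficient_decrease f E I c \<eta> (\<theta> k) (x k) (B k) (d k) (\<tau> ^ j'))" for k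
    using run unfolding sqp_run_def by metis
  have summable: "summable (\<lambda>k. norm (d (k + N)))"
  proof (rule exact_steps_summable[where x = "\<lambda>k. x (k + N)" and B = "\<lambda>k. B (k + N)"
        and g = "\<lambda>k. g (k + N)" and lam = "\<lambda>k. lam (Suc (k + N))" and d = "\<lambda>k. d (k + N)",
        OF index_sets D _ h sub g_bound c_C1 c_grad_lipschitz c_C2 iterates_D _ R(2) B_posdef
        params(1-4) step _ \<open>0 \<le> \<theta>bar\<close> \<sigma>(1) l KL])
    show "f z = ereal (h z)" if "z \<in> D" for z using fin X(2) that by blast
    show "0 \<le> R" using R(1) by simp
    show "\<exists>j. x (Suc k + N) = x (k + N) + \<tau> ^ j *\<^sub>R d (k + N) \<and>
        sufficient_decrease f E I c \<eta> \<theta>bar (x (k + N)) (B (k + N)) (d (k + N)) (\<tau> ^ j) \<and>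
        (\<forall>j'<j. \<not> sufficient_decrease f E I c \<eta> \<theta>bar (x (k + N)) (B (k + N)) (d (k + N)) (\<tau> ^ j'))" for k
      using move[of "k + N"] N[of "k + N"] by simp
  qed
  have d: "(\<lambda>k. d (k + N)) \<longlonglongrightarrow> 0"
    using summable_LIMSEQ_zero[OF summable] by (rule tendsto_norm_zero_cancel)
  \<comment> \<open>Step sizes are powers of \<open>\<tau>\<close>, hence at most 1, so the
    increments are dominated by the summable step norms; telescoping gives convergence of the whole
    sequence.\<close>
  have "summable (\<lambda>k. x (Suc k + N) - x (k + N))"
  proof (rule summable_comparison_test'[OF summable])
    fix k
    obtain j where "x (Suc (k + N)) = x (k + N) + \<tau> ^ j *\<^sub>R d (k + N)" using move by blast
    then show "norm (x (Suc k + N) - x (k + N)) \<le> norm (d (k + N))"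
      using params by (simp add: mult_left_le_one_le power_le_one)
  qed
  from summable_LIMSEQ[OF this] obtain s where "(\<lambda>n. \<Sum>k<n. x (Suc k + N) - x (k + N)) \<longlonglongrightarrow> s" by blast
  then have "(\<lambda>n. x (n + N) - x (0 + N)) \<longlonglongrightarrow> s"
    unfolding sum_lessThan_telescope[of "\<lambda>k. x (k + N)"] .
  from tendsto_add[OF this tendsto_const[of "x (0 + N)"]]
  have x: "(\<lambda>k. x (k + N)) \<longlonglongrightarrow> s + x (0 + N)" by simp
  have "kkt_point f E I c (s + x (0 + N))"
  proof (rule exact_steps_limit_kkt[OF index_sets(1,2) x d step _ _ _ g R(2)])
    show "isCont (c i) (s + x (0 + N))" if "i \<in> E \<union> I" for i
      using c_C1[OF that, of "s + x (0 + N)"] unfolding gderiv_def by (rule has_derivative_continuous)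
    show "isCont (grad (c i)) (s + x (0 + N))" if "i \<in> E \<union> I" for i
    proof -
      from c_grad_lipschitz[OF that] obtain K where "K-lipschitz_on UNIV (grad (c i))" by blast
      then show ?thesis using lipschitz_on_continuous_on by (metis UNIV_I continuous_on_eq_continuous_at open_UNIV)
    qed
    show "bounded (range (\<lambda>k. g (k + N)))" using g_bound by (auto simp: bounded_iff)
  qed
  then show ?thesis using LIMSEQ_offset[OF x] by blast
qed

end
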